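(* Let $P_i\succ0$ ($n\times n$), $\alpha_i\ge0$, $L_i\in\mathbb R^{m\times n}$, $Y_i\succ0$ ($n\times n$) for $i\in\mathcal I$, $\Pi=[\pi_{i,j}]\in\mathcal M_+$ and $\rho>0$ satisfy, for all $i\in\mathcal I$, $$\begin{bmatrix}\boldsymbol\pi_{-i}^{-1}\boldsymbol P_{-i}^{-1}&(\mathbf 1_{N-1}\otimes I_n)P_i^{-1}&0&0 \\ P_i^{-1}(\mathbf 1_{N-1}\otimes I_n)^\top&-\pi_{i,i}P_i^{-1}-Y_i&-P_i^{-1}&-L_i^\top \\ 0&-P_i^{-1}&0&0 \\ 0&-L_i&0&0\end{bmatrix}-\alpha_i\,\Gamma_i\,\Phi^i\,\Gamma_i^\top\succcurlyeq0,\qquad\Gamma_i:=\begin{bmatrix} 0&0 \\ I&\dot X_i \\ 0&-X_i \\ 0&-U_i\end{bmatrix},$$ $$\begin{bmatrix} Y_i&E_i&(C_iP_i^{-1}+D_iL_i)^\top \\ E_i^\top&\rho I&-F_i^\top \\ C_iP_i^{-1}+D_iL_i&-F_i&I\end{bmatrix}\succ0 .$$ Then the controller $$\sigma(x)=\min\{\operatorname{argmin}_{i\in\mathcal I}x^\top P_ix\},\qquad u(x)=K_{\sigma(x)}x,\qquad K_i:=L_iP_i,$$ globally asymptotically stabilizes (at the origin) the switched system $\dot x=\bar A_\sigma x+\bar B_\sigma u+E_\sigma\psi$, $z=C_\sigma x+D_\sigma u+F_\sigma\psi$. Furthermore, the closed-loop system satisfies $J_\infty<\rho$.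
   Context: Let $\mathcal I=\{1,\dots,N\}$. For each $i\in\mathcal I$: true (unknown) matrices $\bar A_i\in\mathbb R^{n\times n}$, $\bar B_i\in\mathbb R^{n\times m}$; known matrices $C_i\in\mathbb R^{p\times n}$, $D_i\in\mathbb R^{p\times m}$, $E_i\in\mathbb R^{n\times q}$, $F_i\in\mathbb R^{p\times q}$; data matrices $X_i,\dot X_i\in\mathbb R^{n\times T_i}$, $U_i\in\mathbb R^{m\times T_i}$ (here $\dot X_i$ is just a name) satisfying $\dot X_i=\bar A_iX_i+\bar B_iU_i+\bar W_i$ for an unknown $\bar W_i\in\mathcal W_i$, where $$\mathcal W_i:=\Big\{W\in\mathbb R^{n\times T_i}\ \Big|\ \begin{bmatrix} I \\ W^\top\end{bmatrix}^\top\Phi^i\begin{bmatrix} I \\ W^\top\end{bmatrix}\succcurlyeq 0\Big\},\qquad \Phi^i=\begin{bmatrix}\Phi^i_{1,1}&\Phi^i_{1,2} \\ {\Phi^i_{1,2}}^\top&\Phi^i_{2,2}\end{bmatrix}$$ with known symmetric $\Phi^i$ and $\Phi^i_{2,2}\prec0$ ($\Phi^i_{1,1}$ is $n\times n$, $\Phi^i_{2,2}$ is $T_i\times T_i$). $\mathcal M_+:=\{\Pi\in\mathbb R^{N\times N}\mid \pi_{i,j}>0\ \forall i\ne j,\ \sum_{i=1}^N\pi_{i,j}=0\ \forall j\}$. $\boldsymbol P_{-i}:=\mathrm{diag}((P_j)_{j\in\mathcal I\setminus\{i\}})$, $\boldsymbol\pi_{-i}:=\mathrm{diag}((\pi_{j,i}I_n)_{j\in\mathcal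 I\setminus\{i\}})$ (block diagonal, same ordering); $\mathbf 1_{N-1}$ is the all-ones vector. The row blocks of $\Gamma_i$ have heights $(N-1)n,n,n,m$ and its column blocks have widths $n,T_i$. Solution concept. Given a disturbance $\psi:\mathbb R_{\ge0}\to\mathbb R^q$, put $\xi_i(x,t):=(\bar A_i+\bar B_iK_i)x+E_i\psi(t)$, $\mathcal X_i:=\{x\in\mathbb R^n\mid\sigma(x)=i\}$, $\mathrm I(x):=\{i\in\mathcal I\mid$ every neighborhood of $x$ meets $\mathcal X_i\}$, $\dot v_i(x,\xi):=x^\top P_i\xi+\xi^\top P_ix$. A solution of the closed loop is an absolutely continuous $x:\mathbb R_{\ge0}\to\mathbb R^n$ together with weights $a_i(t)\ge0$ ($i\in\mathrm I(x(t))$), $\sum_{i\in\mathrm I(x(t))}a_i(t)=1$, measurable in $t$, such that for almost all $t$, with $x=x(t)$, $a_i=a_i(t)$, $$\dot x(t)=\sum_{i\in\mathrm I(x)}a_i\xi_i(x,t)\quad\text{and}\quad \dot v_{\sigma(x)}\Big(x,\sum_{i\in\mathrm I(x)}a_i\xi_i(x,t)\Big)\le\sum_{i\in\mathrm I(x)}\dot v_i(x,a_i\xi_i(x,t)).$$ Existence of solutions in this sense is assumed wherever needed. Global asymptotic stability of the origin refers to $\psi\equiv0$: the origin is Lyapunov stable with respect to all such solutions and every such solution converges to $0$. $\mathcal H_\infty$ index. The modified output is $z_a(t):=\sum_{i\in\mathrm I(x(t))}a_i(t)z_i(t)$ with $z_i(t):=(C_i+D_iK_i)x(t)+F_i\psi(t)$.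 Then $J_\infty:=\sup\|z_a\|_2^2/\|\psi\|_2^2$, the supremum being over all $0\neq\psi\in\mathcal L_2$ and all corresponding solutions with $x(0)=0$; here $\|s\|_2^2=\int_0^\infty s(t)^\top s(t)\,dt$ and $\mathcal L_2$ is the set of signals with finite $\|\cdot\|_2$. *)

theory Defs
  imports "HOL-Analysis.Analysis" "HOL-Library.Function_Algebras"
begin

section \<open>Matrices over finite index sets\<close>

text \<open>
  The number of samples depends on the mode and the block diagonal matrices run over all
  modes but one, so these sizes are not fixed by types.  A matrix that involves them is a
  function of its row and column index, only the entries with indices in finite carrier sets
  being meaningful.  Zero, sum, difference and negation are the pointwise operations on functions;
  the product and the order relations take the carrier as an argument.  Block matrices are
  indexed by sum types, with carriers formed by \<open><+>\<close>.
\<close>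

type_synonym ('r, 'c) fmat = "'r \<Rightarrow> 'c \<Rightarrow> real"

definition ent :: "real ^ 'c ^ 'r \<Rightarrow> ('r, 'c) fmat" where
  "ent A = (\<lambda>r c. A $ r $ c)"

definition eye :: "('r, 'r) fmat" where
  "eye = (\<lambda>r c. if r = c then 1 else 0)"

definition ftr :: "('r, 'c) fmat \<Rightarrow> ('c, 'r) fmat" where
  "ftr A = (\<lambda>r c. A c r)"

definition fscale :: "real \<Rightarrow> ('r, 'c) fmat \<Rightarrow> ('r, 'c) fmat" (infixr "*\<^sub>f" 75) where
  "a *\<^sub>f A = (\<lambda>r c. a * A r c)"

definition fmul :: "('r, 's) fmat \<Rightarrow> 's set \<Rightarrow> ('s, 'c) fmat \<Rightarrow> ('r, 'c) fmat"
    ("_ \<odot>\<^bsub>_\<^esub> _" [71, 0, 70] 70) where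
  "A \<odot>\<^bsub>S\<^esub> B = (\<lambda>r c. \<Sum>s\<in>S. A r s * B s c)"

definition fmat_eq_on :: "'r set \<Rightarrow> 'c set \<Rightarrow> ('r, 'c) fmat \<Rightarrow> ('r, 'c) fmat \<Rightarrow> bool" where
  "fmat_eq_on R S A B \<longleftrightarrow> (\<forall>r\<in>R. \<forall>c\<in>S. A r c = B r c)"

definition finv :: "'r set \<Rightarrow> ('r, 'r) fmat \<Rightarrow> ('r, 'r) fmat" where
  "finv S A = (SOME B. fmat_eq_on S S (A \<odot>\<^bsub>S\<^esub> B) eye \<and> fmat_eq_on S S (B \<odot>\<^bsub>S\<^esub> A) eye)"

definition hcat :: "('r, 'c) fmat \<Rightarrow> ('r, 'd) fmat \<Rightarrow> ('r, 'c + 'd) fmat" (infixr "|||" 62) where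
  "A ||| B = (\<lambda>r. case_sum (A r) (B r))"

definition vcat :: "('r, 'c) fmat \<Rightarrow> ('s, 'c) fmat \<Rightarrow> ('r + 's, 'c) fmat" (infixr "'/'/'/" 61) where
  "A /// B = case_sum A B"

definition block_diag :: "('k \<Rightarrow> ('r, 'c) fmat) \<Rightarrow> ('k \<times> 'r, 'k \<times> 'c) fmat" where
  "block_diag M = (\<lambda>(j, r) (k, c). if j = k then M j r c else 0)"

text \<open>The Kronecker product of an all-ones column vector with the identity.\<close>

definition ones_kron_eye :: "('k \<times> 'r, 'r) fmat" where
  "ones_kron_eye = (\<lambda>(j, r). eye r)"

definition fsym :: "'r set \<Rightarrow> ('r, 'r) fmat \<Rightarrow> bool" where
  "fsym S A \<longleftrightarrow> fmat_eq_on S S (ftr A) A"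

definition fpsd :: "'r set \<Rightarrow> ('r, 'r) fmat \<Rightarrow> bool" where
  "fpsd S A \<longleftrightarrow> fsym S A \<and> (\<forall>v. 0 \<le> (\<Sum>r\<in>S. \<Sum>c\<in>S. v r * A r c * v c))"

definition fpd :: "'r set \<Rightarrow> ('r, 'r) fmat \<Rightarrow> bool" where
  "fpd S A \<longleftrightarrow> fsym S A \<and>
     (\<forall>v. (\<exists>r\<in>S. v r \<noteq> 0) \<longrightarrow> 0 < (\<Sum>r\<in>S. \<Sum>c\<in>S. v r * A r c * v c))"

definition fnd :: "'r set \<Rightarrow> ('r, 'r) fmat \<Rightarrow> bool" where
  "fnd S A \<longleftrightarrow> fpd S (- A)"

section \<open>Data and matrix inequalities\<close>

definition noise_set :: "nat \<Rightarrow> ('n::finite + nat, 'n + nat) fmat \<Rightarrow> ('n, nat) fmat set" where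
  "noise_set T \<Phi> = {W.
     (let S = UNIV <+> {1..T}; IW = eye /// ftr W
      in fpsd UNIV (ftr IW \<odot>\<^bsub>S\<^esub> (\<Phi> \<odot>\<^bsub>S\<^esub> IW)))}"

definition block22 :: "('r + 's, 'r + 's) fmat \<Rightarrow> ('s, 's) fmat" where
  "block22 \<Phi> = (\<lambda>r c. \<Phi> (Inr r) (Inr c))"

definition Mplus :: "nat \<Rightarrow> (nat \<Rightarrow> nat \<Rightarrow> real) set" where
  "Mplus N = {\<pi>. (\<forall>i\<in>{1..N}. \<forall>j\<in>{1..N}. i \<noteq> j \<longrightarrow> 0 < \<pi> i j) \<and>
                 (\<forall>j\<in>{1..N}. (\<Sum>i=1..N. \<pi> i j) = 0)}"

definition others :: "nat \<Rightarrow> nat \<Rightarrow> (nat \<times> 'n) set" where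
  "others N i = ({1..N} - {i}) \<times> UNIV"

definition Gam :: "('n, nat) fmat \<Rightarrow> ('n, nat) fmat \<Rightarrow> ('m, nat) fmat
    \<Rightarrow> ((nat \<times> 'n) + 'n + 'n + 'm, 'n + nat) fmat" where
  "Gam Xd X U =
       (0   ||| 0)
   /// (eye ||| Xd)
   /// (0   ||| - X)
   /// (0   ||| - U)"

definition lmi_stab :: "nat \<Rightarrow> (nat \<Rightarrow> real ^ 'n ^ 'n) \<Rightarrow> (nat \<Rightarrow> nat \<Rightarrow> real)
    \<Rightarrow> real ^ 'n ^ 'n \<Rightarrow> real ^ 'n ^ 'm \<Rightarrow> nat
    \<Rightarrow> ((nat \<times> 'n) + 'n + 'n + 'm, (nat \<times> 'n) + 'n + 'n + 'm) fmat" where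
  "lmi_stab N P \<pi> Y L i =
    (let S = others N i;
         Pm = block_diag (\<lambda>j. ent (P j));
         \<pi>m = block_diag (\<lambda>j. \<pi> j i *\<^sub>f eye);
         Q = ent (matrix_inv (P i))
     in
          (finv S \<pi>m \<odot>\<^bsub>S\<^esub> finv S Pm    ||| ones_kron_eye \<odot>\<^bsub>UNIV\<^esub> Q   ||| 0   ||| 0)
      /// (Q \<odot>\<^bsub>UNIV\<^esub> ftr ones_kron_eye ||| - (\<pi> i i *\<^sub>f Q) - ent Y      ||| - Q ||| - ftr (ent L))
      /// (0                         ||| - Q                         ||| 0   ||| 0)
      /// (0                         ||| - ent L                     ||| 0   ||| 0))"

definition lmi_perf :: "real ^ 'n ^ 'n \<Rightarrow> real ^ 'q ^ 'n \<Rightarrow> real ^ 'q ^ 'p \<Rightarrow> real ^ 'n ^ 'p \<Rightarrow> real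
    \<Rightarrow> ('n + 'q + 'p, 'n + 'q + 'p) fmat" where
  "lmi_perf Y E F G \<rho> =
       (ent Y       ||| ent E     ||| ftr (ent G))
   /// (ftr (ent E) ||| \<rho> *\<^sub>f eye  ||| - ftr (ent F))
   /// (ent G       ||| - ent F   ||| eye)"

section \<open>Closed-loop solutions\<close>

text \<open>Absolute continuity on every compact subinterval of the half line.\<close>

definition abs_cont_halfline :: "(real \<Rightarrow> 'a::real_normed_vector) \<Rightarrow> bool" where
  "abs_cont_halfline f \<longleftrightarrow> (\<forall>b\<ge>0. \<forall>\<epsilon>>0. \<exists>\<delta>>0. \<forall>D.
     finite D \<and> (\<forall>(s, t)\<in>D. 0 \<le> s \<and> s \<le> t \<and> t \<le> b) \<and>
     disjoint_family_on (\<lambda>(s, t). {s<..<t}) D \<and> (\<Sum>(s, t)\<in>D. t - s) < \<delta>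
     \<longrightarrow> (\<Sum>(s, t)\<in>D. norm (f t - f s)) < \<epsilon>)"

definition switch_rule :: "nat \<Rightarrow> (nat \<Rightarrow> real ^ 'n ^ 'n) \<Rightarrow> real ^ 'n \<Rightarrow> nat" where
  "switch_rule N P x = Min {i. is_arg_min (\<lambda>i. x \<bullet> (P i *v x)) (\<lambda>i. i \<in> {1..N}) i}"

definition xi :: "(nat \<Rightarrow> real ^ 'n ^ 'n) \<Rightarrow> (nat \<Rightarrow> real ^ 'm ^ 'n) \<Rightarrow> (nat \<Rightarrow> real ^ 'q ^ 'n)
    \<Rightarrow> (nat \<Rightarrow> real ^ 'n ^ 'm) \<Rightarrow> (real \<Rightarrow> real ^ 'q) \<Rightarrow> nat \<Rightarrow> real ^ 'n \<Rightarrow> real \<Rightarrow> real ^ 'n" where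
  "xi A B E K \<psi> i x t = (A i + B i ** K i) *v x + E i *v \<psi> t"

definition active :: "nat \<Rightarrow> (real ^ 'n \<Rightarrow> nat) \<Rightarrow> real ^ 'n \<Rightarrow> nat set" where
  "active N \<sigma> x = {i \<in> {1..N}. \<forall>V. open V \<and> x \<in> V \<longrightarrow> V \<inter> {y. \<sigma> y = i} \<noteq> {}}"

definition vdot :: "(nat \<Rightarrow> real ^ 'n ^ 'n) \<Rightarrow> nat \<Rightarrow> real ^ 'n \<Rightarrow> real ^ 'n \<Rightarrow> real" where
  "vdot P i x y = x \<bullet> (P i *v y) + y \<bullet> (P i *v x)"

text \<open>
  A solution is a pair of a trajectory \<open>x\<close> and weights \<open>a\<close>.  The weight \<open>a i t\<close> matters only
  where mode \<open>i\<close> belongs to \<open>active N \<sigma> (x t)\<close>; values at negative times are irrelevant.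
\<close>

definition cl_solution :: "nat \<Rightarrow> (nat \<Rightarrow> real ^ 'n ^ 'n) \<Rightarrow> (real ^ 'n \<Rightarrow> nat)
    \<Rightarrow> (nat \<Rightarrow> real ^ 'n ^ 'n) \<Rightarrow> (nat \<Rightarrow> real ^ 'm ^ 'n) \<Rightarrow> (nat \<Rightarrow> real ^ 'q ^ 'n)
    \<Rightarrow> (nat \<Rightarrow> real ^ 'n ^ 'm) \<Rightarrow> (real \<Rightarrow> real ^ 'q)
    \<Rightarrow> (real \<Rightarrow> real ^ 'n) \<Rightarrow> (nat \<Rightarrow> real \<Rightarrow> real) \<Rightarrow> bool" where
  "cl_solution N P \<sigma> A B E K \<psi> x a \<longleftrightarrow>
     abs_cont_halfline x \<and>
     (\<forall>t\<ge>0. (\<forall>i\<in>active N \<sigma> (x t). 0 \<le> a i t) \<and> (\<Sum>i\<in>active N \<sigma> (x t). a i t) = 1) \<and>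
     (\<forall>i\<in>{1..N}. set_borel_measurable lebesgue {t. 0 \<le> t \<and> i \<in> active N \<sigma> (x t)} (a i)) \<and>
     (AE t in lebesgue. 0 \<le> t \<longrightarrow>
        (x has_vector_derivative (\<Sum>i\<in>active N \<sigma> (x t). a i t *\<^sub>R xi A B E K \<psi> i (x t) t))
          (at t within {0..}) \<and>
        vdot P (\<sigma> (x t)) (x t) (\<Sum>i\<in>active N \<sigma> (x t). a i t *\<^sub>R xi A B E K \<psi> i (x t) t)
          \<le> (\<Sum>i\<in>active N \<sigma> (x t). vdot P i (x t) (a i t *\<^sub>R xi A B E K \<psi> i (x t) t)))"

definition glob_asym_stable :: "nat \<Rightarrow> (nat \<Rightarrow> real ^ 'n ^ 'n) \<Rightarrow> (real ^ 'n \<Rightarrow> nat)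
    \<Rightarrow> (nat \<Rightarrow> real ^ 'n ^ 'n) \<Rightarrow> (nat \<Rightarrow> real ^ 'm ^ 'n) \<Rightarrow> (nat \<Rightarrow> real ^ 'q ^ 'n)
    \<Rightarrow> (nat \<Rightarrow> real ^ 'n ^ 'm) \<Rightarrow> bool" where
  "glob_asym_stable N P \<sigma> A B E K \<longleftrightarrow>
     (\<forall>\<epsilon>>0. \<exists>\<delta>>0. \<forall>x a. cl_solution N P \<sigma> A B E K (\<lambda>t. 0) x a \<and> norm (x 0) < \<delta>
        \<longrightarrow> (\<forall>t\<ge>0. norm (x t) < \<epsilon>)) \<and>
     (\<forall>x a. cl_solution N P \<sigma> A B E K (\<lambda>t. 0) x a \<longrightarrow> (x \<longlongrightarrow> 0) at_top)"

definition sq_L2_norm :: "(real \<Rightarrow> real ^ 'd) \<Rightarrow> ennreal" where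
  "sq_L2_norm s = (\<integral>\<^sup>+t\<in>{0..}. ennreal (s t \<bullet> s t) \<partial>lebesgue)"

definition L2_signals :: "(real \<Rightarrow> real ^ 'd) set" where
  "L2_signals = {s. set_borel_measurable lebesgue {0..} s \<and> sq_L2_norm s < \<infinity>}"

definition output_a :: "nat \<Rightarrow> (real ^ 'n \<Rightarrow> nat) \<Rightarrow> (nat \<Rightarrow> real ^ 'n ^ 'p) \<Rightarrow> (nat \<Rightarrow> real ^ 'm ^ 'p)
    \<Rightarrow> (nat \<Rightarrow> real ^ 'q ^ 'p) \<Rightarrow> (nat \<Rightarrow> real ^ 'n ^ 'm) \<Rightarrow> (real \<Rightarrow> real ^ 'q)
    \<Rightarrow> (real \<Rightarrow> real ^ 'n) \<Rightarrow> (nat \<Rightarrow> real \<Rightarrow> real) \<Rightarrow> real \<Rightarrow> real ^ 'p" where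
  "output_a N \<sigma> C D F K \<psi> x a t =
     (\<Sum>i\<in>active N \<sigma> (x t). a i t *\<^sub>R ((C i + D i ** K i) *v x t + F i *v \<psi> t))"

text \<open>
  The supremum is taken in the extended nonnegative reals.  A nonzero element of the Lebesgue
  space is one of nonzero norm.
\<close>

definition J_inf :: "nat \<Rightarrow> (nat \<Rightarrow> real ^ 'n ^ 'n) \<Rightarrow> (real ^ 'n \<Rightarrow> nat)
    \<Rightarrow> (nat \<Rightarrow> real ^ 'n ^ 'n) \<Rightarrow> (nat \<Rightarrow> real ^ 'm ^ 'n) \<Rightarrow> (nat \<Rightarrow> real ^ 'n ^ 'p)
    \<Rightarrow> (nat \<Rightarrow> real ^ 'm ^ 'p) \<Rightarrow> (nat \<Rightarrow> real ^ 'q ^ 'n) \<Rightarrow> (nat \<Rightarrow> real ^ 'q ^ 'p)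
    \<Rightarrow> (nat \<Rightarrow> real ^ 'n ^ 'm) \<Rightarrow> ennreal" where
  "J_inf N P \<sigma> A B C D E F K =
     Sup {sq_L2_norm (output_a N \<sigma> C D F K \<psi> x a) / sq_L2_norm \<psi> | \<psi> x a.
            \<psi> \<in> L2_signals \<and> sq_L2_norm \<psi> \<noteq> 0 \<and>
            cl_solution N P \<sigma> A B E K \<psi> x a \<and> x 0 = 0}"

end

theory Submission
  imports Defs
begin

text \<open>
  The Lyapunov function is \<open>V x = min\<^sub>i x\<^sup>T P\<^sub>i x\<close>. Evaluating the first matrix inequality at
  \<open>((- \<pi>\<^sub>j\<^sub>i P\<^sub>j x)\<^sub>j, \<eta>, A\<^sup>T \<eta>, B\<^sup>T \<eta>)\<close> with \<open>\<eta> = P\<^sub>i x\<close> removes the unknown noise and gives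
  \<open>2 \<eta>\<^sup>T (A + B K) x \<le> - (\<Sum>\<^sub>j \<pi>\<^sub>j\<^sub>i x\<^sup>T P\<^sub>j x) - \<eta>\<^sup>T Y \<eta>\<close>. A mode that is active at \<open>x\<close> minimizes
  \<open>x\<^sup>T P\<^sub>j x\<close>, and the columns of \<open>\<Pi>\<close> sum to zero, so the first sum is nonnegative there. The second,
  strict, inequality turns \<open>- \<eta>\<^sup>T Y \<eta>\<close> into the supply rate \<open>(\<rho> - \<epsilon>) |\<psi>|\<^sup>2 - |z\<^sub>i|\<^sup>2\<close>.

  Along a solution, \<open>V\<close> is absolutely continuous and almost everywhere differentiable, and where it is,
  its derivative is that of every minimizing quadratic form, in particular of the form of the mode
  chosen by the switching rule. The solution concept bounds this derivative by the convex combination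
  of the mode-wise estimates, which are then integrated.
\<close>

section \<open>Almost everywhere differentiability of minima\<close>

text \<open>The obstacle is the switching surface: there \<open>V\<close> has no gradient and the
  velocity blends several modes, so no chain rule applies to \<open>V\<close> along a solution. Two
  facts replace it. A quadratic form that lies above \<open>V\<close> along the trajectory and
  touches it at one instant must share its derivative there, by Fermat's criterion. And a gauge
  argument integrates a one-sided bound on the derivative that holds almost everywhere, asking only
  that the bound be integrable, not the derivative.

  Strictness of the gain estimate is the other delicate point, since a supremum of ratios below
  \<rho> may equal \<rho>. A margin common to all modes is therefore drawn from the strict second
  inequality by compactness of the unit sphere, and the supremum is bounded by \<rho> minus this
  margin. The first inequality is only semidefinite; without disturbance the strict decrease of
  \<open>V\<close> comes from the definiteness of \<open>Y\<close>.\<close>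

lemma countable_isolated_points:
  fixes S :: "'a::second_countable_topology set"
  assumes "\<And>x. x \<in> S \<Longrightarrow> \<not> x islimpt S"
  shows "countable S"
proof -
  have "\<exists>T. open T \<and> x \<in> T \<and> T \<inter> S \<subseteq> {x}" if "x \<in> S" for x
    using assms[OF that] unfolding islimpt_def by auto
  then obtain T where T: "\<And>x. x \<in> S \<Longrightarrow> open (T x) \<and> x \<in> T x \<and> T x \<inter> S \<subseteq> {x}"
    by metis
  \<comment> \<open>Each chosen neighbourhood contains a single point of \<open>S\<close>, so a
    countable subcover leaves room for only countably many points.\<close>
  obtain \<F>' where F: "\<F>' \<subseteq> T ` S" "countable \<F>'" "\<Union>\<F>' = \<Union>(T ` S)"
    by (rule Lindelof[of "T ` S"]) (use T in auto)
  then obtain C where C: "C \<subseteq> S" "countable C" "\<F>' = T ` C"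
    using countable_subset_image[of \<F>' T S] by auto
  have "S \<subseteq> C"
  proof
    fix x assume x: "x \<in> S"
    then have "x \<in> \<Union>(T ` S)" using T by auto
    then have "x \<in> \<Union>(T ` C)" using F(3) C(3) by simp
    then obtain y where y: "y \<in> C" "x \<in> T y" by auto
    then have "T y \<inter> S \<subseteq> {y}" using T C(1) by auto
    then show "x \<in> C" using x y by auto
  qed
  then show ?thesis using C countable_subset by blast
qed

text \<open>Near \<open>t\<close> the difference quotient cannot vanish because its limit
  \<open>d\<close> is nonzero; since \<open>f t = 0\<close>, this excludes further zeros. A
  transversal crossing of two graphs is such a zero of their difference.\<close>

lemma not_islimpt_zeros_DERIV:
  fixes f :: "real \<Rightarrow> real"
  assumes "(f has_real_derivative d) (at t)" "f t = 0" "d \<noteq> 0"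
  shows "\<not> t islimpt {s. f s = 0}"
proof -
  have "((\<lambda>s. (f s - f t) / (s - t)) \<longlongrightarrow> d) (at t)"
    using assms(1) by (simp add: has_field_derivative_iff)
  then have "\<forall>\<^sub>F s in at t. (f s - f t) / (s - t) \<noteq> 0"
    using assms(3) by (rule tendsto_imp_eventually_ne)
  then have "\<forall>\<^sub>F s in at t. s \<notin> {s. f s = 0}"
    by eventually_elim (use assms(2) in auto)
  then show ?thesis
    by (simp add: islimpt_iff_eventually)
qed

lemma DERIV_min_strict:
  fixes f g :: "real \<Rightarrow> real"
  assumes f: "(f has_real_derivative c) (at t)" and g: "isCont g t" and less: "f t < g t"
  shows "((\<lambda>s. min (f s) (g s)) has_real_derivative c) (at t)"
proof -
  have "((\<lambda>s. g s - f s) \<longlongrightarrow> g t - f t) (nhds t)"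
    using g DERIV_isCont[OF f] unfolding continuous_at tendsto_at_iff_tendsto_nhds
    by (intro tendsto_diff)
  then have "\<forall>\<^sub>F s in nhds t. 0 < g s - f s"
    using less by (intro order_tendstoD(1)) auto
  then have "\<forall>\<^sub>F s in nhds t. min (f s) (g s) = f s"
    by eventually_elim simp
  then have "((\<lambda>s. min (f s) (g s)) has_real_derivative c) (at t) \<longleftrightarrow> (f has_real_derivative c) (at t)"
    by (rule DERIV_cong_ev[OF refl _ refl])
  then show ?thesis using f by simp
qed

text \<open>Since \<open>f t = g t\<close>, each difference quotient of the minimum is the quotient
  of \<open>f\<close> or that of \<open>g\<close>, and both tend to \<open>c\<close>.\<close>

lemma DERIV_min_tangent:
  fixes f g :: "real \<Rightarrow> real"
  assumes f: "(f has_real_derivative c) (at t)" and g: "(g has_real_derivative c) (at t)"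
    and eq: "f t = g t"
  shows "((\<lambda>s. min (f s) (g s)) has_real_derivative c) (at t)"
proof -
  have "((\<lambda>s. (f s - f t) / (s - t)) \<longlongrightarrow> c) (at t)" "((\<lambda>s. (g s - g t) / (s - t)) \<longlongrightarrow> c) (at t)"
    using f g by (simp_all add: has_field_derivative_iff)
  then have "((\<lambda>s. (min (f s) (g s) - min (f t) (g t)) / (s - t)) \<longlongrightarrow> c) (at t)"
    unfolding tendsto_iff
  proof (intro allI impI)
    fix e :: real assume "0 < e"
      and "\<forall>e>0. \<forall>\<^sub>F s in at t. dist ((f s - f t) / (s - t)) c < e"
      and "\<forall>e>0. \<forall>\<^sub>F s in at t. dist ((g s - g t) / (s - t)) c < e"
    then have "\<forall>\<^sub>F s in at t. dist ((f s - f t) / (s - t)) c < e"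
      "\<forall>\<^sub>F s in at t. dist ((g s - g t) / (s - t)) c < e"
      by blast+
    then show "\<forall>\<^sub>F s in at t. dist ((min (f s) (g s) - min (f t) (g t)) / (s - t)) c < e"
      by eventually_elim (use eq in \<open>auto simp: min_def\<close>)
  qed
  then show ?thesis
    by (simp add: has_field_derivative_iff)
qed

lemma DERIV_min_ex:
  fixes f g :: "real \<Rightarrow> real"
  assumes f: "(f has_real_derivative c) (at t)" and g: "(g has_real_derivative d) (at t)"
    and tan: "f t = g t \<Longrightarrow> c = d"
  shows "\<exists>e. ((\<lambda>s. min (f s) (g s)) has_real_derivative e) (at t)"
proof -
  consider "f t < g t" | "g t < f t" | "f t = g t" by linarith
  then show ?thesis
  proof cases
    case 1
    then show ?thesis using DERIV_min_strict f g DERIV_isCont by blast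
  next
    case 2
    then show ?thesis using DERIV_min_strict[OF g DERIV_isCont[OF f]]
      by (auto simp: min.commute)
  next
    case 3
    then show ?thesis using DERIV_min_tangent f g tan by blast
  qed
qed

text \<open>
  The minimum can fail to be differentiable only where the graphs cross transversally, and such
  points are isolated zeros of the difference.
\<close>

lemma AE_min_differentiable:
  fixes f g :: "real \<Rightarrow> real"
  assumes f: "AE t in lebesgue. t \<in> S \<longrightarrow> (\<exists>d. (f has_real_derivative d) (at t))"
    and g: "AE t in lebesgue. t \<in> S \<longrightarrow> (\<exists>d. (g has_real_derivative d) (at t))"
  shows "AE t in lebesgue. t \<in> S \<longrightarrow> (\<exists>d. ((\<lambda>s. min (f s) (g s)) has_real_derivative d) (at t))"
proof -
  define Z where "Z = {t. f t = g t \<and> (\<exists>c d. (f has_real_derivative c) (at t) \<and>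
     (g has_real_derivative d) (at t) \<and> c \<noteq> d)}"
  have "countable Z"
  proof (rule countable_isolated_points)
    fix t assume "t \<in> Z"
    then obtain c d where *: "f t = g t" "(f has_real_derivative c) (at t)"
      "(g has_real_derivative d) (at t)" "c \<noteq> d" unfolding Z_def by blast
    have "\<not> t islimpt {s. f s - g s = 0}"
      using * by (intro not_islimpt_zeros_DERIV[of _ "c - d"] derivative_intros) auto
    moreover have "Z \<subseteq> {s. f s - g s = 0}" unfolding Z_def by auto
    ultimately show "\<not> t islimpt Z" using islimpt_subset by blast
  qed
  then have "AE t in lebesgue. t \<notin> Z"
    by (intro AE_not_in null_sets_completionI countable_imp_null_set_lborel)
  with f g show ?thesis
  proof eventually_elim
    case (elim t)
    show ?case
    proof
      assume "t \<in> S"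
      then obtain c d where cd: "(f has_real_derivative c) (at t)" "(g has_real_derivative d) (at t)"
        using elim by blast
      then have "c = d" if "f t = g t"
        using elim(3) that unfolding Z_def by blast
      with cd show "\<exists>d. ((\<lambda>s. min (f s) (g s)) has_real_derivative d) (at t)"
        by (rule DERIV_min_ex)
    qed
  qed
qed

lemma AE_Min_differentiable:
  fixes f :: "'i \<Rightarrow> real \<Rightarrow> real"
  assumes "finite I" "I \<noteq> {}"
    and "\<And>i. i \<in> I \<Longrightarrow> AE t in lebesgue. t \<in> S \<longrightarrow> (\<exists>d. (f i has_real_derivative d) (at t))"
  shows "AE t in lebesgue. t \<in> S \<longrightarrow> (\<exists>d. ((\<lambda>s. MIN i\<in>I. f i s) has_real_derivative d) (at t))"
  using assms
proof (induction I rule: finite_ne_induct)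
  case (singleton i)
  then show ?case by simp
next
  case (insert i I)
  then show ?case
    using AE_min_differentiable[of S "f i" "\<lambda>s. MIN i\<in>I. f i s"] by simp
qed

text \<open>Fermat's criterion for \<open>f - g\<close>, which attains its minimum at
  \<open>t\<close>. It will identify the derivative of the minimum of the forms with that of one
  minimizing form.\<close>

lemma DERIV_eq_touching_below:
  fixes f g :: "real \<Rightarrow> real"
  assumes "(f has_real_derivative c) (at t)" "(g has_real_derivative d) (at t)"
    and "\<And>s. g s \<le> f s" "g t = f t"
  shows "c = d"
proof -
  have "((\<lambda>s. f s - g s) has_real_derivative c - d) (at t)"
    using assms by (intro derivative_intros)
  then have "c - d = 0"
    by (rule DERIV_local_min[of _ _ _ 1]) (use assms in \<open>auto simp: algebra_simps\<close>)
  then show ?thesis by simp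
qed

text \<open>The straddle estimate. As \<open>t\<close> lies between \<open>u\<close> and
  \<open>v\<close>, the errors \<open>e * (v - t)\<close> and \<open>e * (t - u)\<close> of the two
  sides add up to \<open>e * (v - u)\<close>, hence over a whole division to \<open>e\<close> times
  its length.\<close>

lemma DERIV_imp_straddle_le:
  fixes f :: "real \<Rightarrow> real"
  assumes f: "(f has_real_derivative d) (at t)" and e: "e > 0"
  shows "\<exists>r>0. \<forall>u v. u \<le> t \<longrightarrow> t \<le> v \<longrightarrow> u \<in> ball t r \<longrightarrow> v \<in> ball t r \<longrightarrow>
    f v - f u \<le> (d + e) * (v - u)"
proof -
  have "(f has_derivative (\<lambda>h. h * d)) (at t)"
    using f by (simp add: has_field_derivative_def mult_commute_abs)
  then obtain r where r: "r > 0" and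
    *: "\<And>y. norm (y - t) < r \<Longrightarrow> norm (f y - f t - (y - t) * d) \<le> e * norm (y - t)"
    using e unfolding has_derivative_within_alt by (auto simp: has_derivative_at_alt)
  show ?thesis
  proof (intro exI[of _ r] conjI allI impI r)
    fix u v assume uv: "u \<le> t" "t \<le> v" "u \<in> ball t r" "v \<in> ball t r"
    have "f v - f t - (v - t) * d \<le> e * (v - t)" using *[of v] uv by (auto simp: dist_real_def abs_le_iff)
    moreover have "- (f u - f t - (u - t) * d) \<le> e * (t - u)" using *[of u] uv by (auto simp: dist_real_def abs_le_iff)
    ultimately show "f v - f u \<le> (d + e) * (v - u)" by (simp add: algebra_simps)
  qed
qed

section \<open>Integrating derivative bounds of absolutely continuous functions\<close>

lemma open_cover_null_set:
  fixes N :: "real set"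
  assumes "N \<in> null_sets lebesgue" "0 < d"
  obtains G where "open G" "N \<subseteq> G" "G \<in> lmeasurable" "measure lebesgue G < d"
proof -
  obtain G where G: "open G" "N \<subseteq> G" "emeasure lebesgue (G - N) < ennreal d"
    by (rule sets_lebesgue_outer_open[of N d]) (use assms in auto)
  have "emeasure lebesgue G = emeasure lebesgue (G - N)"
    using emeasure_Diff_null_set[OF assms(1), of G] G(1) by simp
  then have less: "emeasure lebesgue G < ennreal d" using G(3) by simp
  then have G': "G \<in> lmeasurable"
    using G(1) by (intro fmeasurableI) (auto intro: less_trans)
  then have "measure lebesgue G < d"
    using less assms(2) by (simp add: emeasure_eq_measure2 ennreal_less_iff)
  then show thesis using that G G' by blast
qed

text \<open>Endpoints are written as \<open>Inf k\<close> and \<open>Sup k\<close> because the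
  telescoping sum \<open>additive_tagged_division_1\<close> has this form.\<close>

lemma tagged_division_real_member:
  fixes t :: real
  assumes "p tagged_division_of {a..b}" "(t, k) \<in> p"
  shows "k = {Inf k..Sup k}" "Inf k \<le> t" "t \<le> Sup k" "measure lborel k = Sup k - Inf k"
    "a \<le> Inf k" "Sup k \<le> b"
proof -
  obtain u v where k: "k = {u..v}" using tagged_division_ofD(4)[OF assms] by auto
  have t: "t \<in> k" using tagged_division_ofD(2)[OF assms] .
  then have uv: "u \<le> v" using k by auto
  moreover have "k \<subseteq> {a..b}" using tagged_division_ofD(3)[OF assms] .
  ultimately show "k = {Inf k..Sup k}" "Inf k \<le> t" "t \<le> Sup k" "measure lborel k = Sup k - Inf k"
    "a \<le> Inf k" "Sup k \<le> b"
    using k t by auto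
qed

text \<open>Nonoverlapping intervals inside an open set of measure below the \<open>d\<close> of
  absolute continuity have total length below \<open>d\<close>. The set \<open>G\<close> is fixed
  before the division \<open>p\<close>, so it can serve as the value of a gauge at the points of
  \<open>N\<close>.\<close>

lemma abs_cont_sum_tags_in_null_set:
  fixes f :: "real \<Rightarrow> real"
  assumes "abs_cont_halfline f" "0 \<le> a" "a \<le> b" "N \<in> null_sets lebesgue" "0 < e"
  obtains G where "open G" "N \<subseteq> G"
    "\<And>p. \<lbrakk>p tagged_division_of {a..b}; \<And>t k. \<lbrakk>(t, k) \<in> p; t \<in> N\<rbrakk> \<Longrightarrow> k \<subseteq> G\<rbrakk>
       \<Longrightarrow> (\<Sum>(t, k)\<in>p. if t \<in> N then \<bar>f (Sup k) - f (Inf k)\<bar> else 0) < e"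
proof -
  obtain d where d: "0 < d" and ac: "\<And>D. \<lbrakk>finite D; \<forall>(s, t)\<in>D. 0 \<le> s \<and> s \<le> t \<and> t \<le> b;
     disjoint_family_on (\<lambda>(s, t). {s<..<t}) D; (\<Sum>(s, t)\<in>D. t - s) < d\<rbrakk>
     \<Longrightarrow> (\<Sum>(s, t)\<in>D. norm (f t - f s)) < e"
    using assms(1)[unfolded abs_cont_halfline_def, rule_format, of b e] assms by auto
  obtain G where G: "open G" "N \<subseteq> G" "G \<in> lmeasurable" "measure lebesgue G < d"
    using open_cover_null_set[OF assms(4) d] .
  show thesis
  proof (rule that[OF G(1,2)])
    fix p assume p: "p tagged_division_of {a..b}"
      and fine: "\<And>t k. \<lbrakk>(t, k) \<in> p; t \<in> N\<rbrakk> \<Longrightarrow> k \<subseteq> G"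
    note mem = tagged_division_real_member[OF p]
    have fin: "finite p" using p by auto
    \<comment> \<open>Degenerate intervals are dropped: they have zero increment, and on the
      remaining ones disjointness of the nonempty interiors makes \<open>ends\<close>
      injective.\<close>
    define q where "q = {(t, k) \<in> p. t \<in> N \<and> Inf k < Sup k}"
    have q: "q \<subseteq> p" "finite q" unfolding q_def using fin by (auto intro: finite_subset)
    define ends where "ends = (\<lambda>(t::real, k::real set). (Inf k, Sup k))"
    have int: "interior k = {Inf k<..<Sup k}" if "(t, k) \<in> p" for t k
      using mem(1)[OF that] interior_atLeastAtMost_real by metis
    have disj: "{Inf k<..<Sup k} \<inter> {Inf k'<..<Sup k'} = {}"
      if "(t, k) \<in> q" "(t', k') \<in> q" "(t, k) \<noteq> (t', k')" for t k t' k'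
      using tagged_division_ofD(5)[OF p _ _ that(3)] that q int by (metis subsetD)
    have inj: "inj_on ends q"
    proof (rule inj_onI)
      fix z z' assume z: "z \<in> q" "z' \<in> q" "ends z = ends z'"
      obtain t k t' k' where zz: "z = (t, k)" "z' = (t', k')" by (metis surj_pair)
      show "z = z'"
      proof (rule ccontr)
        assume "z \<noteq> z'"
        then have "{Inf k<..<Sup k} \<inter> {Inf k'<..<Sup k'} = {}" using disj z zz by auto
        moreover have "Inf k' = Inf k" "Sup k' = Sup k" "Inf k < Sup k"
          using z zz by (auto simp: ends_def q_def)
        ultimately show False using dense[of "Inf k" "Sup k"] by auto
      qed
    qed
    have dj: "disjoint_family_on (\<lambda>z. {fst (ends z)<..<snd (ends z)}) q"
    proof (unfold disjoint_family_on_def, intro ballI impI)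
      fix z z' assume "z \<in> q" "z' \<in> q" "z \<noteq> z'"
      then show "{fst (ends z)<..<snd (ends z)} \<inter> {fst (ends z')<..<snd (ends z')} = {}"
        using disj[of "fst z" "snd z" "fst z'" "snd z'"] by (simp add: ends_def case_prod_unfold)
    qed
    have "(\<Sum>z\<in>q. snd (ends z) - fst (ends z)) = (\<Sum>z\<in>q. measure lebesgue {fst (ends z)<..<snd (ends z)})"
      by (intro sum.cong) (auto simp: q_def ends_def)
    also have "\<dots> = measure lebesgue (\<Union>z\<in>q. {fst (ends z)<..<snd (ends z)})"
      using q(2) dj by (intro measure_finite_Union[symmetric]) (auto simp: q_def ends_def)
    also have "\<dots> \<le> measure lebesgue G"
    proof (rule measure_mono_fmeasurable)
      show "(\<Union>z\<in>q. {fst (ends z)<..<snd (ends z)}) \<subseteq> G"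
      proof (clarsimp simp: ends_def)
        fix t k x assume *: "(t, k) \<in> q" "Inf k < x" "x < Sup k"
        then have "(t, k) \<in> p" "t \<in> N" by (auto simp: q_def)
        then have "k \<subseteq> G" "k = {Inf k..Sup k}" using fine mem(1) by auto
        then show "x \<in> G" using * by (metis atLeastAtMost_iff less_imp_le subsetD)
      qed
      show "(\<Union>z\<in>q. {fst (ends z)<..<snd (ends z)}) \<in> sets lebesgue"
        using q(2) by (intro sets.finite_UN) auto
    qed (use G in auto)
    finally have len: "(\<Sum>z\<in>q. snd (ends z) - fst (ends z)) < d" using G by simp
    have "(\<Sum>(s, t)\<in>ends ` q. norm (f t - f s)) < e"
    proof (rule ac)
      show "finite (ends ` q)" using q by simp
      show "\<forall>(s, t)\<in>ends ` q. 0 \<le> s \<and> s \<le> t \<and> t \<le> b"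
        using mem(5,6) q assms(2) by (force simp: ends_def q_def)
      show "disjoint_family_on (\<lambda>(s, t). {s<..<t}) (ends ` q)"
        using dj unfolding disjoint_family_on_def by (auto simp: case_prod_unfold)
      show "(\<Sum>(s, t)\<in>ends ` q. t - s) < d"
        using len by (simp add: sum.reindex[OF inj] case_prod_unfold)
    qed
    then have "(\<Sum>z\<in>q. \<bar>f (snd (ends z)) - f (fst (ends z))\<bar>) < e"
      by (simp add: sum.reindex[OF inj] case_prod_unfold)
    moreover have "(\<Sum>(t, k)\<in>p. if t \<in> N then \<bar>f (Sup k) - f (Inf k)\<bar> else 0)
        = (\<Sum>z\<in>q. \<bar>f (snd (ends z)) - f (fst (ends z))\<bar>)"
    proof (rule sum.mono_neutral_cong_right[OF fin q(1)])
      show "\<forall>z\<in>p - q. (case z of (t, k) \<Rightarrow> if t \<in> N then \<bar>f (Sup k) - f (Inf k)\<bar> else 0) = 0"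
      proof (clarsimp)
        fix t k assume *: "(t, k) \<in> p" "(t, k) \<notin> q" "t \<in> N"
        then have "Inf k = Sup k" using mem(2,3)[OF *(1)] by (auto simp: q_def)
        then show "f (Sup k) = f (Inf k)" by simp
      qed
    qed (auto simp: q_def ends_def)
    ultimately show "(\<Sum>(t, k)\<in>p. if t \<in> N then \<bar>f (Sup k) - f (Inf k)\<bar> else 0) < e" by simp
  qed
qed

text \<open>
  Take a gauge that is fine for the integral of \<open>h\<close> and for the derivative of \<open>f\<close> off an exceptional
  null set, and that confines intervals tagged in that null set to an open set of small measure; there
  absolute continuity controls the increments of \<open>f\<close>.
\<close>

lemma abs_cont_halfline_diff_le_integral:
  fixes f h :: "real \<Rightarrow> real"
  assumes ac: "abs_cont_halfline f" and ab: "0 \<le> a" "a \<le> b" and h: "h integrable_on {a..b}"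
    and der: "AE t in lebesgue. t \<in> {a<..<b} \<longrightarrow> (\<exists>d. (f has_real_derivative d) (at t) \<and> d \<le> h t)"
  shows "f b - f a \<le> integral {a..b} h"
proof (rule field_le_epsilon)
  fix \<epsilon> :: real assume "0 < \<epsilon>"
  \<comment> \<open>The error budget: \<open>e * (b - a)\<close> for the straddle estimates,
    \<open>e\<close> for the Riemann sum, and \<open>e\<close> for the intervals tagged in the null
    set.\<close>
  define e where "e = \<epsilon> / (b - a + 2)"
  have "e * (b - a + 2) = \<epsilon>" "0 < e"
    using \<open>0 < \<epsilon>\<close> ab by (auto simp: e_def)
  then have e: "0 < e" "e * (b - a) + 2 * e = \<epsilon>"
    by (auto simp: algebra_simps)
  obtain N0 where N0: "N0 \<in> null_sets lebesgue"
    "\<And>t. t \<notin> N0 \<Longrightarrow> t \<in> {a<..<b} \<Longrightarrow> \<exists>d. (f has_real_derivative d) (at t) \<and> d \<le> h t"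
    using AE_E3[OF der] by (auto simp: space_completion)
  \<comment> \<open>The endpoints join the exceptional set because the bound on the derivative is
    given on the open interval only.\<close>
  define N where "N = N0 \<union> {a, b}"
  have N: "N \<in> null_sets lebesgue"
    unfolding N_def using N0 negligible_iff_null_sets[of "{a,b}"] by (intro null_sets.Un) auto
  obtain G where G: "open G" "N \<subseteq> G" and
    small: "\<And>p. \<lbrakk>p tagged_division_of {a..b}; \<And>t k. \<lbrakk>(t, k) \<in> p; t \<in> N\<rbrakk> \<Longrightarrow> k \<subseteq> G\<rbrakk>
       \<Longrightarrow> (\<Sum>(t, k)\<in>p. if t \<in> N then \<bar>f (Sup k) - f (Inf k)\<bar> else 0) < e"
    using abs_cont_sum_tags_in_null_set[OF ac ab N e(1)] by blast
  \<comment> \<open>Setting the integrand to zero on \<open>N\<close> keeps the integral and removes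
    the tags in \<open>N\<close> from the Riemann sum, where \<open>h\<close> has no relation to
    \<open>f\<close>.\<close>
  define h' where "h' t = (if t \<in> N then 0 else h t)" for t
  have "(h' has_integral integral {a..b} h) {a..b}"
    by (rule has_integral_spike[of N _ _ h])
      (use N h in \<open>auto simp: h'_def negligible_iff_null_sets\<close>)
  then have "\<exists>\<gamma>. gauge \<gamma> \<and> (\<forall>p. p tagged_division_of {a..b} \<and> \<gamma> fine p \<longrightarrow>
      norm ((\<Sum>(t, k)\<in>p. measure lborel k *\<^sub>R h' t) - integral {a..b} h) < e)"
    using e(1) unfolding has_integral_real by simp
  then obtain \<gamma> where \<gamma>: "gauge \<gamma>" "\<And>p. p tagged_division_of {a..b} \<Longrightarrow> \<gamma> fine p \<Longrightarrow>
      norm ((\<Sum>(t, k)\<in>p. measure lborel k *\<^sub>R h' t) - integral {a..b} h) < e"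
    by auto
  have "\<exists>r>0. t \<in> {a..b} - N \<longrightarrow> (\<forall>u v. u \<le> t \<longrightarrow> t \<le> v \<longrightarrow> u \<in> ball t r \<longrightarrow> v \<in> ball t r \<longrightarrow>
      f v - f u \<le> (h t + e) * (v - u))" for t
  proof (cases "t \<in> {a..b} - N")
    case True
    then have "t \<notin> N0" "t \<in> {a<..<b}" by (auto simp: N_def)
    then obtain d where d: "(f has_real_derivative d) (at t)" "d \<le> h t" using N0(2) by auto
    obtain r where r: "r > 0"
      "\<And>u v. \<lbrakk>u \<le> t; t \<le> v; u \<in> ball t r; v \<in> ball t r\<rbrakk> \<Longrightarrow> f v - f u \<le> (d + e) * (v - u)"
      using DERIV_imp_straddle_le[OF d(1) e(1)] by auto
    have "f v - f u \<le> (h t + e) * (v - u)"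
      if "u \<le> t" "t \<le> v" "u \<in> ball t r" "v \<in> ball t r" for u v
    proof -
      have "(d + e) * (v - u) \<le> (h t + e) * (v - u)" using d that by (intro mult_right_mono) auto
      then show ?thesis using r(2)[OF that] by simp
    qed
    then show ?thesis using r(1) by (intro exI[of _ r]) auto
  qed (auto intro: exI[of _ 1])
  then obtain r where r: "\<And>t. r t > 0" "\<And>t u v. \<lbrakk>t \<in> {a..b} - N; u \<le> t; t \<le> v; u \<in> ball t (r t);
      v \<in> ball t (r t)\<rbrakk> \<Longrightarrow> f v - f u \<le> (h t + e) * (v - u)"
    by metis
  define \<gamma>' where "\<gamma>' t = (if t \<in> N then G else ball t (r t))" for t
  have "gauge \<gamma>'" using G r(1) by (auto simp: gauge_def \<gamma>'_def)
  with \<gamma>(1) have "gauge (\<lambda>t. \<gamma> t \<inter> \<gamma>' t)" by (rule gauge_Int)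
  then obtain p where "p tagged_division_of {a..b}" "(\<lambda>t. \<gamma> t \<inter> \<gamma>' t) fine p"
    by (rule fine_division_exists_real)
  then have p: "p tagged_division_of {a..b}" "\<gamma> fine p" "\<gamma>' fine p"
    by (auto simp: fine_Int)
  note mem = tagged_division_real_member[OF p(1)]
  have "f b - f a = (\<Sum>(t, k)\<in>p. f (Sup k) - f (Inf k))"
    using additive_tagged_division_1[OF ab(2) p(1), of f] by simp
  also have "\<dots> \<le> (\<Sum>(t, k)\<in>p. (measure lborel k *\<^sub>R h' t + e * measure lborel k)
      + (if t \<in> N then \<bar>f (Sup k) - f (Inf k)\<bar> else 0))"
  proof (rule sum_mono, clarify)
    fix t k assume tk: "(t, k) \<in> p"
    note m = mem[OF tk]
    show "f (Sup k) - f (Inf k) \<le> measure lborel k *\<^sub>R h' t + e * measure lborel k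
      + (if t \<in> N then \<bar>f (Sup k) - f (Inf k)\<bar> else 0)"
    proof (cases "t \<in> N")
      case True
      have "0 \<le> e * (Sup k - Inf k)" using e(1) m(2,3) by simp
      then show ?thesis using True m(4) by (simp add: h'_def)
    next
      case False
      have "k \<subseteq> ball t (r t)" using fineD[OF p(3) tk] False by (simp add: \<gamma>'_def)
      moreover have "Inf k \<in> k" "Sup k \<in> k" using m(1-3)
        by (metis atLeastAtMost_iff order.refl order.trans)+
      ultimately have "f (Sup k) - f (Inf k) \<le> (h t + e) * (Sup k - Inf k)"
        using m False by (intro r(2)) auto
      then show ?thesis using False by (simp add: h'_def m(4) algebra_simps)
    qed
  qed
  also have "\<dots> = (\<Sum>(t, k)\<in>p. measure lborel k *\<^sub>R h' t) + e * (\<Sum>(t, k)\<in>p. measure lborel k)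
      + (\<Sum>(t, k)\<in>p. if t \<in> N then \<bar>f (Sup k) - f (Inf k)\<bar> else 0)"
    by (simp add: sum.distrib sum_distrib_left case_prod_unfold)
  also have "(\<Sum>(t, k)\<in>p. measure lborel k) = b - a"
    using additive_content_tagged_division[of p a b] p(1) ab by simp
  also have "(\<Sum>(t, k)\<in>p. if t \<in> N then \<bar>f (Sup k) - f (Inf k)\<bar> else 0) < e"
  proof (rule small[OF p(1)])
    show "k \<subseteq> G" if "(t, k) \<in> p" "t \<in> N" for t k
      using fineD[OF p(3) that(1)] that(2) by (simp add: \<gamma>'_def)
  qed
  finally show "f b - f a \<le> integral {a..b} h + \<epsilon>"
    using \<gamma>(2)[OF p(1,2)] e(2) by (simp add: abs_less_iff)
qed

section \<open>Bilinear forms of matrices over finite index sets\<close>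

text \<open>Separate carriers and vectors for rows and columns let a form be split block by block,
  off-diagonal blocks included; the definiteness conditions are the case of equal arguments.\<close>

definition bil :: "'r set \<Rightarrow> 'c set \<Rightarrow> ('r, 'c) fmat \<Rightarrow> ('r \<Rightarrow> real) \<Rightarrow> ('c \<Rightarrow> real) \<Rightarrow> real" where
  "bil R S A u v = (\<Sum>r\<in>R. \<Sum>c\<in>S. u r * A r c * v c)"

lemma bil_zero [simp]: "bil R S 0 u v = 0"
  by (simp add: bil_def)

lemma bil_uminus [simp]: "bil R S (- A) u v = - bil R S A u v"
  by (simp add: bil_def sum_negf)

lemma bil_diff [simp]: "bil R S (A - B) u v = bil R S A u v - bil R S B u v"
  by (simp add: bil_def algebra_simps sum_subtractf)

lemma bil_fscale [simp]: "bil R S (a *\<^sub>f A) u v = a * bil R S A u v"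
  by (simp add: bil_def fscale_def sum_distrib_left mult_ac)

lemma bil_ftr: "bil R S (ftr A) u v = bil S R A v u"
  unfolding bil_def ftr_def by (subst sum.swap) (simp add: mult_ac)

lemma bil_vcat:
  assumes "finite R" "finite R'"
  shows "bil (R <+> R') S (A /// B) u v = bil R S A (u \<circ> Inl) v + bil R' S B (u \<circ> Inr) v"
  using assms by (simp add: bil_def vcat_def sum.Plus)

lemma bil_hcat:
  assumes "finite S" "finite S'"
  shows "bil R (S <+> S') (A ||| B) u v = bil R S A u (v \<circ> Inl) + bil R S' B u (v \<circ> Inr)"
  using assms by (simp add: bil_def hcat_def sum.Plus sum.distrib)

lemma bil_fmul:
  "bil R S (A \<odot>\<^bsub>T\<^esub> B) u v = (\<Sum>t\<in>T. (\<Sum>r\<in>R. u r * A r t) * (\<Sum>c\<in>S. B t c * v c))"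
proof -
  have "bil R S (A \<odot>\<^bsub>T\<^esub> B) u v = (\<Sum>r\<in>R. \<Sum>c\<in>S. \<Sum>t\<in>T. (u r * A r t) * (B t c * v c))"
    by (simp add: bil_def fmul_def sum_distrib_left sum_distrib_right mult_ac)
  also have "\<dots> = (\<Sum>r\<in>R. \<Sum>t\<in>T. \<Sum>c\<in>S. (u r * A r t) * (B t c * v c))"
    by (intro sum.cong refl sum.swap)
  also have "\<dots> = (\<Sum>t\<in>T. \<Sum>r\<in>R. \<Sum>c\<in>S. (u r * A r t) * (B t c * v c))"
    by (rule sum.swap)
  also have "\<dots> = (\<Sum>t\<in>T. (\<Sum>r\<in>R. u r * A r t) * (\<Sum>c\<in>S. B t c * v c))"
    by (simp add: sum_product)
  finally show ?thesis .
qed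

text \<open>This reduces both the noise condition and the term with \<open>Gam\<close> to the form
  of the same middle matrix, so that only the transformed vectors have to be compared.\<close>

lemma bil_congruence:
  "bil R R' (A \<odot>\<^bsub>S\<^esub> (M \<odot>\<^bsub>S'\<^esub> B)) u v
    = bil S S' M (\<lambda>s. \<Sum>r\<in>R. u r * A r s) (\<lambda>s. \<Sum>c\<in>R'. B s c * v c)"
proof -
  have "(\<Sum>c\<in>R'. (M \<odot>\<^bsub>S'\<^esub> B) s c * v c) = (\<Sum>t\<in>S'. M s t * (\<Sum>c\<in>R'. B t c * v c))" for s
    unfolding fmul_def sum_distrib_left sum_distrib_right by (subst sum.swap) (simp add: mult_ac)
  then show ?thesis
    unfolding bil_fmul by (simp add: bil_def sum_distrib_left mult.assoc)
qed

lemma bil_cong: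
  assumes "\<And>r. r \<in> R \<Longrightarrow> u r = u' r" "\<And>c. c \<in> S \<Longrightarrow> v c = v' c"
  shows "bil R S A u v = bil R S A u' v'"
  unfolding bil_def using assms by (intro sum.cong refl) auto

lemma bil_ent: "bil UNIV UNIV (ent M) u v = (\<chi> i. u i) \<bullet> (M *v (\<chi> j. v j))"
  by (simp add: bil_def ent_def inner_vec_def matrix_vector_mult_def sum_distrib_left mult_ac)

lemma bil_eye: "bil UNIV UNIV eye u v = (\<chi> i::'a::finite. u i) \<bullet> (\<chi> j. v j)"
  by (simp add: bil_def eye_def inner_vec_def if_distrib if_distribR sum.If_cases cong: if_cong)

lemma fpsdD: "fpsd S A \<Longrightarrow> 0 \<le> bil S S A v v"
  by (simp add: fpsd_def bil_def)

lemma fpdD: "fpd S A \<Longrightarrow> r \<in> S \<Longrightarrow> v r \<noteq> 0 \<Longrightarrow> 0 < bil S S A v v"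
  unfolding fpd_def bil_def by blast

text \<open>The form attains a minimum on the compact unit sphere, which is positive by
  definiteness; homogeneity of degree two extends the bound to all vectors.\<close>

lemma fpd_coercive:
  fixes A :: "('r::finite, 'r) fmat"
  assumes "fpd UNIV A"
  obtains e where "0 < e" "\<And>v. e * (\<Sum>r\<in>UNIV. (v r)\<^sup>2) \<le> bil UNIV UNIV A v v"
proof -
  define q :: "real ^ 'r \<Rightarrow> real" where "q x = bil UNIV UNIV A (\<lambda>r. x $ r) (\<lambda>r. x $ r)" for x
  have "continuous_on (sphere 0 1) q"
    unfolding q_def bil_def by (intro continuous_intros)
  moreover have "sphere (0::real^'r) 1 \<noteq> {}" by simp
  ultimately obtain y where y: "y \<in> sphere 0 1" "\<And>x. x \<in> sphere 0 1 \<Longrightarrow> q y \<le> q x"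
    using continuous_attains_inf[OF compact_sphere] by metis
  have "y \<noteq> 0" using y(1) by auto
  then obtain r where "y $ r \<noteq> 0" by (auto simp: vec_eq_iff)
  then have pos: "0 < q y" unfolding q_def using fpdD[OF assms, of r] by auto
  show thesis
  proof (rule that[OF pos])
    fix v :: "'r \<Rightarrow> real"
    define x where "x = (\<chi> r. v r)"
    have nx: "(\<Sum>r\<in>UNIV. (v r)\<^sup>2) = (norm x)\<^sup>2"
      unfolding power2_norm_eq_inner by (simp add: x_def inner_vec_def power2_eq_square)
    have qx: "bil UNIV UNIV A v v = q x" by (simp add: q_def x_def)
    show "q y * (\<Sum>r\<in>UNIV. (v r)\<^sup>2) \<le> bil UNIV UNIV A v v"
    proof (cases "x = 0")
      case True
      then show ?thesis unfolding nx qx by (simp add: q_def bil_def)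
    next
      case False
      have "q y \<le> q (inverse (norm x) *\<^sub>R x)" using False by (intro y(2)) simp
      also have "\<dots> = (inverse (norm x))\<^sup>2 * q x"
        by (simp add: q_def bil_def sum_distrib_left power2_eq_square mult_ac)
      finally show ?thesis unfolding nx qx using False by (simp add: field_simps)
    qed
  qed
qed

lemma fpd_ent_sym: "fpd UNIV (ent M) \<Longrightarrow> transpose M = M"
  by (simp add: fpd_def fsym_def fmat_eq_on_def ftr_def ent_def transpose_def vec_eq_iff)

lemma inner_sym_matrix:
  fixes M :: "real ^ 'n ^ 'n"
  assumes "transpose M = M"
  shows "x \<bullet> (M *v y) = (M *v x) \<bullet> y"
  using dot_lmul_matrix[of x M y] vector_transpose_matrix[of x M] assms by simp

lemma fpd_ent_pos:
  assumes "fpd UNIV (ent M)" "x \<noteq> 0"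
  shows "0 < x \<bullet> (M *v x)"
proof -
  obtain r where "x $ r \<noteq> 0" using assms(2) by (auto simp: vec_eq_iff)
  then have "0 < bil UNIV UNIV (ent M) (\<lambda>r. x $ r) (\<lambda>r. x $ r)" using fpdD[OF assms(1)] by auto
  then show ?thesis by (simp add: bil_ent)
qed

lemma fpd_ent_coercive:
  fixes M :: "real ^ 'n::finite ^ 'n"
  assumes "fpd UNIV (ent M)"
  obtains e where "0 < e" "\<And>x. e * (norm x)\<^sup>2 \<le> x \<bullet> (M *v x)"
proof -
  obtain e where e: "0 < e" "\<And>v. e * (\<Sum>r\<in>UNIV. (v r)\<^sup>2) \<le> bil UNIV UNIV (ent M) v v"
    using fpd_coercive[OF assms] by metis
  have "e * (norm x)\<^sup>2 \<le> x \<bullet> (M *v x)" for x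
  proof -
    have "(\<Sum>r\<in>UNIV. (x $ r)\<^sup>2) = (norm x)\<^sup>2"
      unfolding power2_norm_eq_inner by (simp add: inner_vec_def power2_eq_square)
    then show ?thesis using e(2)[of "\<lambda>r. x $ r"] by (simp add: bil_ent)
  qed
  with e(1) show thesis using that by metis
qed

lemma fpd_ent_inverse:
  assumes "fpd UNIV (ent M)"
  shows "M ** matrix_inv M = mat 1" "matrix_inv M ** M = mat 1"
proof -
  have "\<forall>x. M *v x = 0 \<longrightarrow> x = 0"
    using fpd_ent_pos[OF assms] by fastforce
  then have "invertible M"
    using matrix_left_invertible_ker[of M] by (simp add: invertible_left_inverse)
  then have "\<exists>B. M ** B = mat 1 \<and> B ** M = mat 1"
    by (simp add: invertible_def)
  then have "M ** matrix_inv M = mat 1 \<and> matrix_inv M ** M = mat 1"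
    unfolding matrix_inv_def by (rule someI_ex)
  then show "M ** matrix_inv M = mat 1" "matrix_inv M ** M = mat 1" by auto
qed

lemma matrix_inv_cancel:
  assumes "fpd UNIV (ent M)"
  shows "M *v (matrix_inv M *v x) = x" "matrix_inv M *v (M *v x) = x"
  by (simp_all add: matrix_vector_mul_assoc fpd_ent_inverse[OF assms])

section \<open>Inverses of block diagonal matrices over finite carriers\<close>

lemma fmul_eye_right: "finite S \<Longrightarrow> c \<in> S \<Longrightarrow> (\<Sum>s\<in>S. A r s * eye s c) = (A r c :: real)"
  by (simp add: eye_def if_distrib cong: if_cong)

lemma fmul_eye_left: "finite S \<Longrightarrow> r \<in> S \<Longrightarrow> (\<Sum>s\<in>S. eye r s * A s c) = (A r c :: real)"
  by (simp add: eye_def if_distribR if_distrib cong: if_cong)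

text \<open>\<open>finv\<close> is a choice constrained on the carrier only, so equality can be
  claimed only there. With \<open>F\<close> the chosen inverse,
  \<open>F = F (A B) = (F A) B = B\<close>; the given \<open>B\<close> also shows that the choice
  has a witness.\<close>

lemma finv_unique:
  assumes S: "finite S" and AB: "fmat_eq_on S S (A \<odot>\<^bsub>S\<^esub> B) eye" and BA: "fmat_eq_on S S (B \<odot>\<^bsub>S\<^esub> A) eye"
  shows "fmat_eq_on S S (finv S A) B"
  unfolding fmat_eq_on_def
proof (intro ballI)
  fix r c assume rc: "r \<in> S" "c \<in> S"
  let ?F = "finv S A"
  have FA: "fmat_eq_on S S (?F \<odot>\<^bsub>S\<^esub> A) eye"
    unfolding finv_def by (rule someI2[of _ B]) (use AB BA in auto)
  have "?F r c = (\<Sum>s\<in>S. ?F r s * (A \<odot>\<^bsub>S\<^esub> B) s c)"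
    using AB rc fmul_eye_right[OF S, of c ?F r] by (simp add: fmat_eq_on_def)
  also have "\<dots> = (\<Sum>s\<in>S. (?F \<odot>\<^bsub>S\<^esub> A) r s * B s c)"
    unfolding fmul_def sum_distrib_left sum_distrib_right by (subst sum.swap) (simp add: mult_ac)
  also have "\<dots> = B r c"
    using FA rc fmul_eye_left[OF S, of r B c] by (simp add: fmat_eq_on_def)
  finally show "?F r c = B r c" .
qed

lemma sum_block_diag_row:
  assumes "finite I" "j \<in> I"
  shows "(\<Sum>z\<in>I \<times> UNIV. block_diag M (j, r) z * w z) = (\<Sum>c\<in>UNIV. M j r c * w (j, c :: 'n::finite))"
proof -
  have "(\<Sum>z\<in>I \<times> UNIV. block_diag M (j, r) z * w z)
      = (\<Sum>k\<in>I. \<Sum>c\<in>UNIV. if j = k then M j r c * w (k, c) else 0)"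
    unfolding sum.cartesian_product by (intro sum.cong) (auto simp: block_diag_def)
  also have "\<dots> = (\<Sum>k\<in>I. if j = k then (\<Sum>c\<in>UNIV. M j r c * w (k, c)) else 0)"
    by (intro sum.cong) auto
  finally show ?thesis using assms by simp
qed

lemma sum_block_diag_col:
  assumes "finite I" "j \<in> I"
  shows "(\<Sum>z\<in>I \<times> UNIV. w z * block_diag M z (j, c)) = (\<Sum>r\<in>UNIV. w (j, r :: 'n::finite) * M j r c)"
proof -
  have "(\<Sum>z\<in>I \<times> UNIV. w z * block_diag M z (j, c))
      = (\<Sum>k\<in>I. \<Sum>r\<in>UNIV. if j = k then w (k, r) * M j r c else 0)"
    unfolding sum.cartesian_product by (intro sum.cong) (auto simp: block_diag_def)
  also have "\<dots> = (\<Sum>k\<in>I. if j = k then (\<Sum>r\<in>UNIV. w (k, r) * M j r c) else 0)"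
    by (intro sum.cong) auto
  finally show ?thesis using assms by simp
qed

lemma block_diag_fmul_eye:
  fixes M M' :: "'k \<Rightarrow> ('n::finite, 'n) fmat"
  assumes "finite I" "\<And>j. j \<in> I \<Longrightarrow> M j \<odot>\<^bsub>UNIV\<^esub> M' j = eye"
  shows "fmat_eq_on (I \<times> UNIV) (I \<times> UNIV) (block_diag M \<odot>\<^bsub>I \<times> UNIV\<^esub> block_diag M') eye"
  unfolding fmat_eq_on_def
proof (clarify)
  fix j r k c assume jk: "j \<in> I" "k \<in> I"
  have "(block_diag M \<odot>\<^bsub>I \<times> UNIV\<^esub> block_diag M') (j, r) (k, c)
     = (\<Sum>s\<in>UNIV. M j r s * block_diag M' (j, s) (k, c))"
    using sum_block_diag_row[OF assms(1) jk(1)] by (simp add: fmul_def)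
  also have "\<dots> = (if j = k then (M j \<odot>\<^bsub>UNIV\<^esub> M' j) r c else 0)"
    by (simp add: block_diag_def fmul_def)
  also have "\<dots> = eye (j, r) (k, c)" using assms(2)[OF jk(1)] by (auto simp: eye_def)
  finally show "(block_diag M \<odot>\<^bsub>I \<times> UNIV\<^esub> block_diag M') (j, r) (k, c) = eye (j, r) (k, c)" .
qed

lemma finv_block_diag:
  fixes M M' :: "'k \<Rightarrow> ('n::finite, 'n) fmat"
  assumes "finite I" "\<And>j. j \<in> I \<Longrightarrow> M j \<odot>\<^bsub>UNIV\<^esub> M' j = eye" "\<And>j. j \<in> I \<Longrightarrow> M' j \<odot>\<^bsub>UNIV\<^esub> M j = eye"
  shows "fmat_eq_on (I \<times> UNIV) (I \<times> UNIV) (finv (I \<times> UNIV) (block_diag M)) (block_diag M')"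
  using assms by (intro finv_unique block_diag_fmul_eye) auto

lemma ent_fmul: "ent A \<odot>\<^bsub>UNIV\<^esub> ent B = ent (A ** B)"
  by (simp add: ent_def fmul_def matrix_matrix_mult_def)

lemma ent_mat_1: "ent (mat 1) = eye"
  by (auto simp: ent_def mat_def eye_def fun_eq_iff)

lemma fscale_eye_fmul: "(a *\<^sub>f eye) \<odot>\<^bsub>UNIV\<^esub> (b *\<^sub>f eye) = ((a * b) *\<^sub>f (eye :: ('n::finite, 'n) fmat))"
proof -
  have "(\<Sum>s\<in>UNIV. (a * eye r s) * (b * eye s c)) = (a * b) * eye r (c::'n)" for r c
    using fmul_eye_left[of UNIV r eye c]
    by (simp add: sum_distrib_left[symmetric] mult_ac)
  then show ?thesis by (simp add: fscale_def fmul_def)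
qed

section \<open>Consequences of the matrix inequalities\<close>

lemma finite_others [simp]: "finite (others N i :: (nat \<times> 'n::finite) set)"
  by (simp add: others_def)

lemma sum_others: "(\<Sum>z\<in>others N i. f z) = (\<Sum>j\<in>{1..N} - {i}. \<Sum>r\<in>(UNIV :: 'n::finite set). f (j, r))"
  unfolding others_def by (simp add: sum.cartesian_product case_prod_unfold)

text \<open>In the data columns the product is \<open>Xd - A X - B U\<close> tested against \<eta>,
  which the data equation turns into \<open>W\<close>: the unknown system matrices cancel. The block
  \<open>w\<close> is free because the first block row of \<open>Gam\<close> is zero.\<close>

lemma noise_form_eq:
  fixes A :: "real ^ 'n::finite ^ 'n" and B :: "real ^ 'm::finite ^ 'n" and \<eta> :: "real ^ 'n"
  assumes data: "fmat_eq_on UNIV {1..T} Xd (ent A \<odot>\<^bsub>UNIV\<^esub> X + ent B \<odot>\<^bsub>UNIV\<^esub> U + W)"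
    and v: "v = case_sum w (case_sum (($) \<eta>) (case_sum (($) (transpose A *v \<eta>)) (($) (transpose B *v \<eta>))))"
    and s: "s \<in> UNIV <+> {1..T}"
  shows "(\<Sum>r\<in>others N i <+> UNIV <+> UNIV <+> UNIV. v r * Gam Xd X U r s)
    = (\<Sum>c\<in>UNIV. (eye /// ftr W) s c * \<eta> $ c)"
proof (cases s)
  case (Inl c)
  have "(\<Sum>r\<in>others N i <+> UNIV <+> UNIV <+> UNIV. v r * Gam Xd X U r s) = (\<Sum>r\<in>UNIV. \<eta> $ r * eye r c)"
    by (simp add: v Inl Gam_def vcat_def hcat_def sum.Plus del: UNIV_Plus_UNIV)
  also have "\<dots> = \<eta> $ c" using fmul_eye_right[of UNIV c "\<lambda>_. ($) \<eta>"] by simp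
  also have "\<dots> = (\<Sum>c'\<in>UNIV. eye c c' * \<eta> $ c')" using fmul_eye_left[of UNIV c "\<lambda>r _. \<eta> $ r"] by simp
  finally show ?thesis by (simp add: Inl vcat_def)
next
  case (Inr k)
  have Xd: "Xd r k = (\<Sum>l\<in>UNIV. A $ r $ l * X l k) + (\<Sum>l\<in>UNIV. B $ r $ l * U l k) + W r k" for r
    using data s unfolding Inr by (auto simp: fmat_eq_on_def fmul_def ent_def)
  have swap: "(\<Sum>r\<in>UNIV. \<eta> $ r * (\<Sum>l\<in>UNIV. M $ r $ l * Z l)) = (\<Sum>l\<in>UNIV. (transpose M *v \<eta>) $ l * Z l)"
    for M :: "real ^ 'd::finite ^ 'n" and Z
    unfolding matrix_vector_mult_def transpose_def sum_distrib_left
    by (subst sum.swap) (simp add: sum_distrib_left sum_distrib_right mult_ac)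
  have "(\<Sum>r\<in>others N i <+> UNIV <+> UNIV <+> UNIV. v r * Gam Xd X U r s)
     = (\<Sum>r\<in>UNIV. \<eta> $ r * Xd r k) - (\<Sum>l\<in>UNIV. (transpose A *v \<eta>) $ l * X l k)
       - (\<Sum>l\<in>UNIV. (transpose B *v \<eta>) $ l * U l k)"
    by (simp add: v Inr Gam_def vcat_def hcat_def sum.Plus sum_negf del: UNIV_Plus_UNIV)
  also have "\<dots> = (\<Sum>r\<in>UNIV. \<eta> $ r * W r k)"
    unfolding Xd swap[symmetric] by (simp add: distrib_left sum.distrib)
  finally show ?thesis by (simp add: Inr vcat_def ftr_def mult.commute)
qed

lemma bil_lmi_stab:
  fixes \<eta> a :: "real ^ 'n::finite" and b :: "real ^ 'm::finite" and w :: "nat \<times> 'n \<Rightarrow> real"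
    and P :: "nat \<Rightarrow> real ^ 'n ^ 'n" and N i :: nat
  defines "v \<equiv> case_sum w (case_sum (($) \<eta>) (case_sum (($) a) (($) b)))"
  defines "S \<equiv> others N i :: (nat \<times> 'n) set" and "Q \<equiv> matrix_inv (P i)"
  shows "bil (S <+> UNIV <+> UNIV <+> UNIV) (S <+> UNIV <+> UNIV <+> UNIV) (lmi_stab N P \<pi> Y L i) v v
    = bil S S (finv S (block_diag (\<lambda>j. \<pi> j i *\<^sub>f eye)) \<odot>\<^bsub>S\<^esub> finv S (block_diag (\<lambda>j. ent (P j)))) w w
      + bil S UNIV (ones_kron_eye \<odot>\<^bsub>UNIV\<^esub> ent Q) w (($) \<eta>)
      + bil UNIV S (ent Q \<odot>\<^bsub>UNIV\<^esub> ftr ones_kron_eye) (($) \<eta>) w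
      - \<pi> i i * (\<eta> \<bullet> (Q *v \<eta>)) - \<eta> \<bullet> (Y *v \<eta>)
      - \<eta> \<bullet> (Q *v a) - a \<bullet> (Q *v \<eta>) - 2 * (b \<bullet> (L *v \<eta>))"
  unfolding lmi_stab_def Let_def S_def[symmetric] Q_def[symmetric]
  by (simp add: v_def S_def bil_vcat bil_hcat bil_ftr bil_ent case_sum_o_inj vec_lambda_eta
      del: UNIV_Plus_UNIV)

text \<open>The argument \<open>M *v x\<close> cancels the inverse of \<open>M\<close>, so the
  coupling blocks leave plain inner products with \<open>x\<close>.\<close>

lemma bil_ones_kron:
  assumes P: "fpd UNIV (ent M)" and w: "\<And>j r. w (j, r) = y j $ r"
  shows "bil (others N i) UNIV (ones_kron_eye \<odot>\<^bsub>UNIV\<^esub> ent (matrix_inv M)) w (($) (M *v x))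
      = (\<Sum>j\<in>{1..N} - {i}. y j \<bullet> x)"
    and "bil UNIV (others N i) (ent (matrix_inv M) \<odot>\<^bsub>UNIV\<^esub> ftr ones_kron_eye) (($) (M *v x)) w
      = (\<Sum>j\<in>{1..N} - {i}. y j \<bullet> x)"
proof -
  have e: "(\<Sum>z\<in>others N i. w z * ones_kron_eye z t) = (\<Sum>j\<in>{1..N} - {i}. y j $ t)" for t
    unfolding sum_others w ones_kron_eye_def
    using fmul_eye_right[of UNIV t "\<lambda>j r. y j $ r"] by simp
  have q: "(\<Sum>c\<in>UNIV. ent (matrix_inv M) t c * (M *v x) $ c) = x $ t" for t
    using arg_cong[OF matrix_inv_cancel(2)[OF P, of x], of "\<lambda>z. z $ t"]
    by (simp add: matrix_vector_mult_def[of "matrix_inv M"] ent_def)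
  \<comment> \<open>Here the inverse acts from the other side, so the symmetry of \<open>M\<close>
    is needed to move \<open>M\<close> across the inner product before cancelling.\<close>
  have q': "(\<Sum>r\<in>UNIV. (M *v x) $ r * ent (matrix_inv M) r t) = x $ t" for t
  proof -
    have "(\<Sum>r\<in>UNIV. (M *v x) $ r * ent (matrix_inv M) r t) = (M *v x) \<bullet> (matrix_inv M *v axis t 1)"
      by (simp add: inner_vec_def matrix_vector_mult_basis column_def ent_def)
    also have "\<dots> = x \<bullet> axis t 1"
      using inner_sym_matrix[OF fpd_ent_sym[OF P], of x "matrix_inv M *v axis t 1"]
      by (simp add: matrix_inv_cancel[OF P])
    finally show ?thesis by (simp add: inner_axis)
  qed
  have sw: "(\<Sum>t\<in>UNIV. (\<Sum>j\<in>{1..N} - {i}. y j $ t) * x $ t) = (\<Sum>j\<in>{1..N} - {i}. y j \<bullet> x)"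
    unfolding inner_vec_def sum_distrib_right by (subst sum.swap) simp
  show "bil (others N i) UNIV (ones_kron_eye \<odot>\<^bsub>UNIV\<^esub> ent (matrix_inv M)) w (($) (M *v x))
      = (\<Sum>j\<in>{1..N} - {i}. y j \<bullet> x)"
    unfolding bil_fmul e q sw ..
  have e': "(\<Sum>z\<in>others N i. ftr ones_kron_eye t z * w z) = (\<Sum>j\<in>{1..N} - {i}. y j $ t)" for t
    using e[of t] by (simp add: ftr_def mult.commute)
  show "bil UNIV (others N i) (ent (matrix_inv M) \<odot>\<^bsub>UNIV\<^esub> ftr ones_kron_eye) (($) (M *v x)) w
      = (\<Sum>j\<in>{1..N} - {i}. y j \<bullet> x)"
    unfolding bil_fmul e' q' sw[symmetric] by (simp add: mult.commute)
qed

text \<open>On block \<open>j\<close> of \<open>w\<close>, the first inverse removes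
  \<open>p j\<close> and leaves \<open>- P j *v x\<close> (fact \<open>f1\<close>), while the second
  removes \<open>P j\<close> and leaves \<open>- p j\<close> times \<open>x\<close> (fact
  \<open>f2\<close>); the signs cancel in the product.\<close>

lemma bil_finv_finv:
  fixes P :: "nat \<Rightarrow> real ^ 'n::finite ^ 'n" and p :: "nat \<Rightarrow> real"
  assumes P: "\<And>j. j \<in> {1..N} \<Longrightarrow> fpd UNIV (ent (P j))"
    and p: "\<And>j. j \<in> {1..N} - {i} \<Longrightarrow> 0 < p j"
    and w: "\<And>j r. w (j, r) = - (p j * (P j *v x) $ r)"
  shows "bil (others N i) (others N i) (finv (others N i) (block_diag (\<lambda>j. p j *\<^sub>f eye))
      \<odot>\<^bsub>others N i\<^esub> finv (others N i) (block_diag (\<lambda>j. ent (P j)))) w w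
    = (\<Sum>j\<in>{1..N} - {i}. p j * (x \<bullet> (P j *v x)))"
proof -
  let ?I = "{1..N} - {i}"
  have S: "others N i = ?I \<times> (UNIV :: 'n set)" by (simp add: others_def)
  have one: "1 *\<^sub>f M = M" for M :: "('n, 'n) fmat" by (simp add: fscale_def)
  have inv: "(p j *\<^sub>f eye) \<odot>\<^bsub>UNIV\<^esub> (inverse (p j) *\<^sub>f eye) = (eye :: ('n, 'n) fmat)"
    "(inverse (p j) *\<^sub>f eye) \<odot>\<^bsub>UNIV\<^esub> (p j *\<^sub>f eye) = (eye :: ('n, 'n) fmat)" if "j \<in> ?I" for j
    using p[OF that] by (simp_all add: fscale_eye_fmul one)
  have "fmat_eq_on (?I \<times> UNIV) (?I \<times> UNIV) (finv (?I \<times> UNIV) (block_diag (\<lambda>j. p j *\<^sub>f eye)))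
      (block_diag (\<lambda>j. inverse (p j) *\<^sub>f (eye :: ('n, 'n) fmat)))"
    by (rule finv_block_diag) (auto simp: inv)
  note F = this
  have f1: "(\<Sum>z\<in>?I \<times> UNIV. w z * finv (?I \<times> UNIV) (block_diag (\<lambda>j. p j *\<^sub>f eye)) z (j, t))
      = - (P j *v x) $ t" if "j \<in> ?I" for j t
  proof -
    from F have "(\<Sum>z\<in>?I \<times> UNIV. w z * finv (?I \<times> UNIV) (block_diag (\<lambda>j. p j *\<^sub>f eye)) z (j, t))
      = (\<Sum>z\<in>?I \<times> UNIV. w z * block_diag (\<lambda>j. inverse (p j) *\<^sub>f eye) z (j, t))"
      using that by (intro sum.cong) (auto simp: fmat_eq_on_def)
    also have "\<dots> = (\<Sum>r\<in>UNIV. w (j, r) * (inverse (p j) * eye r t))"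
      using that by (subst sum_block_diag_col) (auto simp: fscale_def)
    also have "\<dots> = (\<Sum>r\<in>UNIV. (w (j, r) * inverse (p j)) * eye r t)"
      by (simp add: mult.assoc)
    also have "\<dots> = w (j, t) * inverse (p j)"
      using fmul_eye_right[of UNIV t "\<lambda>_ r. w (j, r) * inverse (p j)"] by simp
    also have "\<dots> = - (P j *v x) $ t" using p[OF that] by (simp add: w)
    finally show ?thesis .
  qed
  have "fmat_eq_on (?I \<times> UNIV) (?I \<times> UNIV) (finv (?I \<times> UNIV) (block_diag (\<lambda>j. ent (P j))))
      (block_diag (\<lambda>j. ent (matrix_inv (P j))))"
    by (rule finv_block_diag) (use P in \<open>auto simp: ent_fmul ent_mat_1 fpd_ent_inverse\<close>)
  note F = this
  have f2: "(\<Sum>z\<in>?I \<times> UNIV. finv (?I \<times> UNIV) (block_diag (\<lambda>j. ent (P j))) (j, t) z * w z)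
      = - p j * x $ t" if "j \<in> ?I" for j t
  proof -
    from F have "(\<Sum>z\<in>?I \<times> UNIV. finv (?I \<times> UNIV) (block_diag (\<lambda>j. ent (P j))) (j, t) z * w z)
      = (\<Sum>z\<in>?I \<times> UNIV. block_diag (\<lambda>j. ent (matrix_inv (P j))) (j, t) z * w z)"
      using that by (intro sum.cong) (auto simp: fmat_eq_on_def)
    also have "\<dots> = (\<Sum>c\<in>UNIV. ent (matrix_inv (P j)) t c * w (j, c))"
      using that by (subst sum_block_diag_row) auto
    also have "\<dots> = - p j * (matrix_inv (P j) *v (P j *v x)) $ t"
      unfolding matrix_vector_mult_def[of "matrix_inv (P j)"]
      by (simp add: w ent_def sum_distrib_left sum_negf mult_ac)
    finally show ?thesis using P that by (simp add: matrix_inv_cancel)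
  qed
  have "bil (?I \<times> UNIV) (?I \<times> UNIV) (finv (?I \<times> UNIV) (block_diag (\<lambda>j. p j *\<^sub>f eye))
      \<odot>\<^bsub>?I \<times> UNIV\<^esub> finv (?I \<times> UNIV) (block_diag (\<lambda>j. ent (P j)))) w w
    = (\<Sum>(j, t)\<in>?I \<times> UNIV. (- (P j *v x) $ t) * (- p j * x $ t))"
    unfolding bil_fmul
  proof (rule sum.cong[OF refl])
    fix z assume "z \<in> ?I \<times> (UNIV :: 'n set)"
    then obtain j t where z: "z = (j, t)" "j \<in> ?I" by (rule SigmaE)
    show "(\<Sum>r\<in>?I \<times> UNIV. w r * finv (?I \<times> UNIV) (block_diag (\<lambda>j. p j *\<^sub>f eye)) r z)
        * (\<Sum>c\<in>?I \<times> UNIV. finv (?I \<times> UNIV) (block_diag (\<lambda>j. ent (P j))) z c * w c)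
      = (case z of (j, t) \<Rightarrow> (- (P j *v x) $ t) * (- p j * x $ t))"
      unfolding z(1) f1[OF z(2)] f2[OF z(2)] by simp
  qed
  also have "\<dots> = (\<Sum>j\<in>?I. \<Sum>t\<in>UNIV. p j * (x $ t * (P j *v x) $ t))"
    unfolding sum.cartesian_product[symmetric] by (intro sum.cong refl) simp
  also have "\<dots> = (\<Sum>j\<in>?I. p j * (x \<bullet> (P j *v x)))"
    by (simp add: inner_vec_def sum_distrib_left)
  finally show ?thesis unfolding S .
qed

lemma lmi_stab_imp_decrease:
  fixes P :: "nat \<Rightarrow> real ^ 'n::finite ^ 'n" and B :: "real ^ 'm::finite ^ 'n"
  assumes i: "i \<in> {1..N}"
    and noise: "W \<in> noise_set T \<Phi>"
    and data: "fmat_eq_on UNIV {1..T} Xd (ent A \<odot>\<^bsub>UNIV\<^esub> X + ent B \<odot>\<^bsub>UNIV\<^esub> U + W)"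
    and P: "\<And>j. j \<in> {1..N} \<Longrightarrow> fpd UNIV (ent (P j))"
    and \<alpha>: "0 \<le> \<alpha>"
    and \<pi>: "\<And>j. j \<in> {1..N} - {i} \<Longrightarrow> 0 < \<pi> j i"
    and lmi: "fpsd (others N i <+> UNIV <+> UNIV <+> UNIV)
        (lmi_stab N P \<pi> Y L i - \<alpha> *\<^sub>f (Gam Xd X U \<odot>\<^bsub>UNIV <+> {1..T}\<^esub>
                    (\<Phi> \<odot>\<^bsub>UNIV <+> {1..T}\<^esub> ftr (Gam Xd X U))))"
  shows "2 * ((P i *v x) \<bullet> ((A + B ** (L ** P i)) *v x))
    \<le> - (\<Sum>j=1..N. \<pi> j i * (x \<bullet> (P j *v x))) - (P i *v x) \<bullet> (Y *v (P i *v x))"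
proof -
  note Pi = P[OF i]
  \<comment> \<open>With the last two blocks equal to \<open>A\<^sup>T \<eta>\<close> and \<open>B\<^sup>T \<eta>\<close>, the transpose of \<open>\<Gamma>\<close> maps the test
    vector to \<open>(\<eta>, W\<^sup>T \<eta>)\<close>, on which the form of \<open>\<Phi>\<close> is nonnegative; the first block is the
    minimizer of the quadratic form over it.\<close>
  define \<eta> where "\<eta> = P i *v x"
  define w where "w = (\<lambda>(j, r). - (\<pi> j i * (P j *v x) $ r))"
  define a where "a = transpose A *v \<eta>"
  define b where "b = transpose B *v \<eta>"
  define v where "v = case_sum w (case_sum (($) \<eta>) (case_sum (($) a) (($) b)))"
  let ?R = "others N i <+> UNIV <+> UNIV <+> UNIV" and ?S = "UNIV <+> {1..T}"
  have \<Gamma>v: "(\<Sum>r\<in>?R. v r * Gam Xd X U r s) = (\<Sum>c\<in>UNIV. (eye /// ftr W) s c * \<eta> $ c)"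
    if "s \<in> ?S" for s
    by (rule noise_form_eq[OF data _ that]) (simp add: v_def a_def b_def)
  have "0 \<le> bil UNIV UNIV (ftr (eye /// ftr W) \<odot>\<^bsub>?S\<^esub> (\<Phi> \<odot>\<^bsub>?S\<^esub> (eye /// ftr W))) (($) \<eta>) (($) \<eta>)"
    using noise by (intro fpsdD) (simp add: noise_set_def Let_def)
  also have "\<dots> = bil ?S ?S \<Phi> (\<lambda>s. \<Sum>r\<in>?R. v r * Gam Xd X U r s) (\<lambda>s. \<Sum>r\<in>?R. ftr (Gam Xd X U) s r * v r)"
    unfolding bil_congruence
  proof (rule bil_cong)
    fix s :: "'n + nat" assume s: "s \<in> ?S"
    show "(\<Sum>r\<in>UNIV. \<eta> $ r * ftr (eye /// ftr W) r s) = (\<Sum>r\<in>?R. v r * Gam Xd X U r s)"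
      unfolding \<Gamma>v[OF s] by (simp add: ftr_def[of "eye /// ftr W"] mult.commute)
    have "(\<Sum>r\<in>?R. ftr (Gam Xd X U) s r * v r) = (\<Sum>r\<in>?R. v r * Gam Xd X U r s)"
      by (simp only: ftr_def mult.commute)
    then show "(\<Sum>c\<in>UNIV. (eye /// ftr W) s c * \<eta> $ c) = (\<Sum>r\<in>?R. ftr (Gam Xd X U) s r * v r)"
      by (simp only: \<Gamma>v[OF s])
  qed
  finally have "0 \<le> bil ?R ?R (Gam Xd X U \<odot>\<^bsub>?S\<^esub> (\<Phi> \<odot>\<^bsub>?S\<^esub> ftr (Gam Xd X U))) v v"
    unfolding bil_congruence .
  \<comment> \<open>The elementary direction of the S-procedure: a nonnegative multiple of a
    nonnegative form is subtracted in the matrix inequality, so what it is subtracted from is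
    nonnegative at \<open>v\<close> too.\<close>
  then have "0 \<le> \<alpha> * bil ?R ?R (Gam Xd X U \<odot>\<^bsub>?S\<^esub> (\<Phi> \<odot>\<^bsub>?S\<^esub> ftr (Gam Xd X U))) v v"
    using \<alpha> by simp
  also have "\<dots> \<le> bil ?R ?R (lmi_stab N P \<pi> Y L i) v v"
    using fpsdD[OF lmi, of v] by simp
  finally have main: "0 \<le> bil ?R ?R (lmi_stab N P \<pi> Y L i) v v" .
  have wy: "w (j, r) = (- \<pi> j i *\<^sub>R (P j *v x)) $ r" for j r
    by (simp add: w_def)
  have t1: "bil (others N i) (others N i) (finv (others N i) (block_diag (\<lambda>j. \<pi> j i *\<^sub>f eye))
      \<odot>\<^bsub>others N i\<^esub> finv (others N i) (block_diag (\<lambda>j. ent (P j)))) w w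
    = (\<Sum>j\<in>{1..N} - {i}. \<pi> j i * (x \<bullet> (P j *v x)))"
    by (rule bil_finv_finv) (use P \<pi> in \<open>auto simp: w_def\<close>)
  have sym: "(P i *v x) \<bullet> y = x \<bullet> (P i *v y)" for y
    using inner_sym_matrix[OF fpd_ent_sym[OF Pi], of x y] by simp
  have q1: "\<eta> \<bullet> (matrix_inv (P i) *v y) = x \<bullet> y" for y
    unfolding \<eta>_def sym by (simp add: matrix_inv_cancel[OF Pi])
  have q2: "matrix_inv (P i) *v \<eta> = x" unfolding \<eta>_def by (simp add: matrix_inv_cancel[OF Pi])
  have ta: "(transpose M *v \<eta>) \<bullet> y = \<eta> \<bullet> (M *v y)" for M :: "real ^ 'd::finite ^ 'n" and y
    using dot_lmul_matrix[of \<eta> M y] by simp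
  have split: "(\<Sum>j=1..N. \<pi> j i * (x \<bullet> (P j *v x)))
      = \<pi> i i * (x \<bullet> (P i *v x)) + (\<Sum>j\<in>{1..N} - {i}. \<pi> j i * (x \<bullet> (P j *v x)))"
    using i by (subst sum.remove[of _ i]) auto
  have ones: "(\<Sum>j\<in>{1..N} - {i}. (- \<pi> j i *\<^sub>R (P j *v x)) \<bullet> x)
      = - (\<Sum>j\<in>{1..N} - {i}. \<pi> j i * (x \<bullet> (P j *v x)))"
    by (simp add: sum_negf inner_commute)
  \<comment> \<open>The first diagonal block contributes the sum over the other modes once with a
    plus sign, and each of the two coupling blocks contributes it with a minus sign; one negative
    copy remains.\<close>
  have "bil ?R ?R (lmi_stab N P \<pi> Y L i) v v
    = - (\<Sum>j\<in>{1..N} - {i}. \<pi> j i * (x \<bullet> (P j *v x))) - \<pi> i i * (x \<bullet> (P i *v x)) - \<eta> \<bullet> (Y *v \<eta>)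
      - 2 * (a \<bullet> x) - 2 * (b \<bullet> (L *v \<eta>))"
    unfolding v_def bil_lmi_stab t1 bil_ones_kron[OF Pi wy, where N = N and i = i and x = x, folded \<eta>_def] ones q1 q2
    by (simp add: inner_commute \<eta>_def)
  moreover have "a \<bullet> x = \<eta> \<bullet> (A *v x)" unfolding a_def by (rule ta)
  moreover have "b \<bullet> (L *v \<eta>) = \<eta> \<bullet> (B *v (L *v \<eta>))" unfolding b_def by (rule ta)
  ultimately show ?thesis
    using main unfolding split \<eta>_def
    by (simp add: matrix_vector_mult_add_rdistrib inner_add_right matrix_vector_mul_assoc matrix_mul_assoc)
qed

section \<open>The performance inequality as a dissipation estimate\<close>

lemma bil_lmi_perf:
  fixes y :: "real ^ 'n::finite" and u :: "real ^ 'q::finite" and z :: "real ^ 'p::finite"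
  defines "v \<equiv> case_sum (($) y) (case_sum (($) u) (($) z))"
  shows "bil UNIV UNIV (lmi_perf Y E F G \<rho>) v v
    = y \<bullet> (Y *v y) + 2 * (y \<bullet> (E *v u)) + \<rho> * (u \<bullet> u) + 2 * (z \<bullet> (G *v y)) - 2 * (z \<bullet> (F *v u)) + z \<bullet> z"
proof -
  have U: "(UNIV :: ('n + 'q + 'p) set) = UNIV <+> UNIV <+> UNIV" by simp
  show ?thesis
    unfolding lmi_perf_def U
    by (simp add: v_def bil_vcat bil_hcat bil_ftr bil_ent bil_eye case_sum_o_inj vec_lambda_eta
      del: UNIV_Plus_UNIV)
qed

lemma lmi_perf_imp_dissipation:
  fixes Y :: "real ^ 'n::finite ^ 'n" and E :: "real ^ 'q::finite ^ 'n" and F :: "real ^ 'q ^ 'p::finite"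
  assumes "fpd UNIV (lmi_perf Y E F G \<rho>)"
  obtains e where "0 < e"
    "\<And>y u. - (y \<bullet> (Y *v y)) + 2 * (y \<bullet> (E *v u)) + (norm (G *v y + F *v u))\<^sup>2 \<le> (\<rho> - e) * (norm u)\<^sup>2"
proof -
  obtain e where e: "0 < e" "\<And>v. e * (\<Sum>r\<in>UNIV. (v r)\<^sup>2) \<le> bil UNIV UNIV (lmi_perf Y E F G \<rho>) v v"
    using fpd_coercive[OF assms] by metis
  have "- (y \<bullet> (Y *v y)) + 2 * (y \<bullet> (E *v u)) + (norm (G *v y + F *v u))\<^sup>2 \<le> (\<rho> - e) * (norm u)\<^sup>2" for y u
  proof -
    \<comment> \<open>The form is evaluated at \<open>(y, - u, z)\<close> with \<open>z\<close> minimizing it.\<close>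
    define g where "g = G *v y + F *v u"
    define z where "z = - g"
    define v where "v = case_sum (($) y) (case_sum (($) (- u)) (($) z))"
    have U: "(UNIV :: ('n + 'q + 'p) set) = UNIV <+> UNIV <+> UNIV" by simp
    have "(\<Sum>r\<in>UNIV. (v r)\<^sup>2) = y \<bullet> y + (u \<bullet> u + z \<bullet> z)"
      unfolding U by (simp add: v_def sum.Plus inner_vec_def power2_eq_square del: UNIV_Plus_UNIV)
    \<comment> \<open>Of the coercivity margin only the disturbance part is kept: it is what lowers
      \<rho> to \<open>\<rho> - e\<close>.\<close>
    then have "u \<bullet> u \<le> (\<Sum>r\<in>UNIV. (v r)\<^sup>2)" by simp
    then have "e * (u \<bullet> u) \<le> e * (\<Sum>r\<in>UNIV. (v r)\<^sup>2)" using e(1) by simp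
    also have "\<dots> \<le> bil UNIV UNIV (lmi_perf Y E F G \<rho>) v v" by (rule e(2))
    also have "\<dots> = y \<bullet> (Y *v y) - 2 * (y \<bullet> (E *v u)) + \<rho> * (u \<bullet> u)
        + 2 * (z \<bullet> g) + z \<bullet> z"
      unfolding v_def bil_lmi_perf by (simp add: g_def inner_add_right linear_neg[OF matrix_vector_mul_linear])
    also have "\<dots> = y \<bullet> (Y *v y) - 2 * (y \<bullet> (E *v u)) + \<rho> * (u \<bullet> u) - z \<bullet> z"
      by (simp add: z_def)
    also have "z \<bullet> z = (norm (G *v y + F *v u))\<^sup>2"
      unfolding g_def[symmetric] by (simp add: z_def power2_norm_eq_inner)
    finally show ?thesis by (simp add: power2_norm_eq_inner algebra_simps)
  qed
  with e(1) show thesis using that by metis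
qed

section \<open>The minimum Lyapunov function along solutions\<close>

lemma switch_rule_argmin:
  assumes "1 \<le> N"
  shows "switch_rule N P x \<in> {1..N}"
    and "j \<in> {1..N} \<Longrightarrow> x \<bullet> (P (switch_rule N P x) *v x) \<le> x \<bullet> (P j *v x)"
proof -
  let ?f = "\<lambda>i. x \<bullet> (P i *v x)"
  let ?S = "{i. is_arg_min ?f (\<lambda>i. i \<in> {1..N}) i}"
  have "finite ?S" by (rule finite_subset[of _ "{1..N}"]) (auto simp: is_arg_min_def)
  moreover have "?S \<noteq> {}"
    using ex_is_arg_min_if_finite[of "{1..N}" ?f] assms by auto
  ultimately have "switch_rule N P x \<in> ?S" unfolding switch_rule_def by (rule Min_in)
  then have "is_arg_min ?f (\<lambda>i. i \<in> {1..N}) (switch_rule N P x)" by simp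
  then show "switch_rule N P x \<in> {1..N}"
    "j \<in> {1..N} \<Longrightarrow> x \<bullet> (P (switch_rule N P x) *v x) \<le> x \<bullet> (P j *v x)"
    by (auto simp: is_arg_min_linorder)
qed

lemma continuous_on_quadratic [continuous_intros]:
  fixes M :: "real ^ 'n ^ 'n"
  shows "continuous_on S (\<lambda>x. x \<bullet> (M *v x))"
  by (intro continuous_intros linear_continuous_on matrix_vector_mul_bounded_linear)

text \<open>If \<open>j\<close> were strictly better at \<open>x\<close>, it would by continuity be
  strictly better on a neighbourhood, where the rule then never selects \<open>i\<close>. So
  optimality extends from the region of a mode to its closure, which covers sliding motion.\<close>

lemma active_argmin:
  assumes "1 \<le> N" "i \<in> active N (switch_rule N P) x" "j \<in> {1..N}"
  shows "x \<bullet> (P i *v x) \<le> x \<bullet> (P j *v x)"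
proof (rule ccontr)
  assume c: "\<not> x \<bullet> (P i *v x) \<le> x \<bullet> (P j *v x)"
  let ?V = "{y. y \<bullet> (P j *v y) < y \<bullet> (P i *v y)}"
  have "open ?V" by (intro open_Collect_less continuous_intros)
  moreover have "x \<in> ?V" using c by auto
  ultimately have "?V \<inter> {y. switch_rule N P y = i} \<noteq> {}"
    using assms(2) unfolding active_def by auto
  then obtain y where "y \<bullet> (P j *v y) < y \<bullet> (P i *v y)" "switch_rule N P y = i" by auto
  then show False using switch_rule_argmin(2)[OF assms(1,3), of y P] by auto
qed

definition Vmin :: "nat \<Rightarrow> (nat \<Rightarrow> real ^ 'n ^ 'n) \<Rightarrow> real ^ 'n \<Rightarrow> real" where
  "Vmin N P x = (MIN i\<in>{1..N}. x \<bullet> (P i *v x))"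

lemma Vmin_le: "i \<in> {1..N} \<Longrightarrow> Vmin N P x \<le> x \<bullet> (P i *v x)"
  unfolding Vmin_def by (rule Min_le) auto

lemma Vmin_switch:
  assumes "1 \<le> N"
  shows "Vmin N P x = x \<bullet> (P (switch_rule N P x) *v x)"
  unfolding Vmin_def
proof (rule Min_eqI)
  show "x \<bullet> (P (switch_rule N P x) *v x) \<in> (\<lambda>i. x \<bullet> (P i *v x)) ` {1..N}"
    using switch_rule_argmin(1)[OF assms] by (rule imageI)
  fix y assume "y \<in> (\<lambda>i. x \<bullet> (P i *v x)) ` {1..N}"
  then obtain j where "j \<in> {1..N}" "y = x \<bullet> (P j *v x)" by (rule imageE)
  then show "x \<bullet> (P (switch_rule N P x) *v x) \<le> y"
    using switch_rule_argmin(2)[OF assms, of j x P] by simp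
qed simp

text \<open>Being quadratic, the minimum is Lipschitz only on balls; along a trajectory over a
  compact interval this is enough to inherit absolute continuity.\<close>

lemma Vmin_lipschitz:
  fixes P :: "nat \<Rightarrow> real ^ 'n::finite ^ 'n"
  assumes "1 \<le> N"
  obtains c where "\<And>x y. \<lbrakk>norm x \<le> R; norm y \<le> R\<rbrakk> \<Longrightarrow> \<bar>Vmin N P x - Vmin N P y\<bar> \<le> c * norm (x - y)"
proof -
  \<comment> \<open>On the ball of radius \<open>R\<close> the form of mode \<open>i\<close> has
    Lipschitz constant \<open>2 * R\<close> times the operator norm of \<open>P i\<close>; the sum
    dominates all of these at once.\<close>
  define c where "c = (\<Sum>i\<in>{1..N}. 2 * R * onorm ((*v) (P i)))"
  have le: "x \<bullet> (P i *v x) - y \<bullet> (P i *v y) \<le> c * norm (x - y)"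
    if R: "norm x \<le> R" "norm y \<le> R" and i: "i \<in> {1..N}" for x y i
  proof -
    have o: "norm (P i *v z) \<le> onorm ((*v) (P i)) * norm z" for z
      by (rule onorm) (rule matrix_vector_mul_bounded_linear)
    have o0: "0 \<le> onorm ((*v) (P k))" for k
      by (rule onorm_pos_le) (rule matrix_vector_mul_bounded_linear)
    have R0: "0 \<le> R" using R(1) norm_ge_zero[of x] by linarith
    have "x \<bullet> (P i *v x) - y \<bullet> (P i *v y) = (x - y) \<bullet> (P i *v x) + y \<bullet> (P i *v (x - y))"
      by (simp add: matrix_vector_mult_diff_distrib inner_diff_left inner_diff_right)
    also have "\<dots> \<le> norm (x - y) * norm (P i *v x) + norm y * norm (P i *v (x - y))"
      by (intro add_mono norm_cauchy_schwarz)
    also have "\<dots> \<le> norm (x - y) * (onorm ((*v) (P i)) * R) + R * (onorm ((*v) (P i)) * norm (x - y))"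
    proof (intro add_mono mult_mono order_refl o)
      show "norm (P i *v x) \<le> onorm ((*v) (P i)) * R"
        using o[of x] mult_left_mono[OF R(1) o0[of i]] by linarith
    qed (use R R0 o0 in auto)
    also have "\<dots> = (2 * R * onorm ((*v) (P i))) * norm (x - y)"
      by (simp add: algebra_simps)
    also have "\<dots> \<le> c * norm (x - y)"
      unfolding c_def using i R0 o0 by (intro mult_right_mono member_le_sum) auto
    finally show ?thesis .
  qed
  \<comment> \<open>The mode selected at \<open>y\<close> is optimal at \<open>y\<close> and merely
    a candidate at \<open>x\<close>, so its form alone bounds the difference from above.\<close>
  have half: "Vmin N P x - Vmin N P y \<le> c * norm (x - y)" if "norm x \<le> R" "norm y \<le> R" for x y
    using Vmin_le[OF switch_rule_argmin(1)[OF assms, of P y], of P x]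
      le[OF that switch_rule_argmin(1)[OF assms, of P y]] Vmin_switch[OF assms, of P y] by linarith
  have "\<bar>Vmin N P x - Vmin N P y\<bar> \<le> c * norm (x - y)" if "norm x \<le> R" "norm y \<le> R" for x y
    using half[OF that] half[OF that(2,1)] by (simp add: norm_minus_commute abs_le_iff)
  then show thesis by (rule that)
qed

lemma abs_cont_halfline_imp_continuous:
  assumes "abs_cont_halfline f"
  shows "continuous_on {0..} f"
  unfolding continuous_on_iff
proof (intro ballI allI impI)
  fix t e :: real assume t: "t \<in> {0..}" and e: "0 < e"
  obtain d where d: "0 < d" and ac: "\<And>D. finite D \<and> (\<forall>(s, t')\<in>D. 0 \<le> s \<and> s \<le> t' \<and> t' \<le> t + 1) \<and>
     disjoint_family_on (\<lambda>(s, t). {s<..<t}) D \<and> (\<Sum>(s, t)\<in>D. t - s) < d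
     \<longrightarrow> (\<Sum>(s, t)\<in>D. norm (f t - f s)) < e"
    \<comment> \<open>The horizon \<open>t + 1\<close> leaves room to the right of \<open>t\<close>;
      the single interval between \<open>s\<close> and \<open>t\<close> then serves as the
      family.\<close>
    using assms[unfolded abs_cont_halfline_def, rule_format, of "t + 1" e] t e by auto
  have "dist (f s) (f t) < e" if s: "s \<in> {0..}" "dist s t < min d 1" for s
  proof -
    have "norm (f (max s t) - f (min s t)) < e"
      using ac[of "{(min s t, max s t)}"] s t
      by (auto simp: disjoint_family_on_def dist_real_def min_def max_def abs_if split: if_splits)
    then show ?thesis by (auto simp: dist_norm min_def max_def norm_minus_commute split: if_splits)
  qed
  then show "\<exists>d>0. \<forall>s\<in>{0..}. dist s t < d \<longrightarrow> dist (f s) (f t) < e"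
    using d by (intro exI[of _ "min d 1"]) auto
qed

lemma abs_cont_halfline_compose:
  fixes g :: "'a::real_normed_vector \<Rightarrow> real"
  assumes f: "abs_cont_halfline f"
    and g: "\<And>R. \<exists>c. \<forall>x y. norm x \<le> R \<longrightarrow> norm y \<le> R \<longrightarrow> \<bar>g x - g y\<bar> \<le> c * norm (x - y)"
  shows "abs_cont_halfline (\<lambda>t. g (f t))"
  unfolding abs_cont_halfline_def
proof (intro allI impI)
  fix b e :: real assume b: "0 \<le> b" and e: "0 < e"
  have "compact (f ` {0..b})"
    using continuous_on_subset[OF abs_cont_halfline_imp_continuous[OF f], of "{0..b}"]
    by (intro compact_continuous_image) auto
  then obtain R where R: "\<And>t. t \<in> {0..b} \<Longrightarrow> norm (f t) \<le> R"
    using compact_imp_bounded[THEN bounded_iff[THEN iffD1]] by (metis imageI)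
  obtain c0 where c0: "\<And>x y. norm x \<le> R \<Longrightarrow> norm y \<le> R \<Longrightarrow> \<bar>g x - g y\<bar> \<le> c0 * norm (x - y)"
    using g by blast
  \<comment> \<open>The constant \<open>c0\<close> may be zero or negative, while
    \<open>e / c\<close> needs a positive divisor.\<close>
  define c where "c = max c0 1"
  have c: "\<bar>g x - g y\<bar> \<le> c * norm (x - y)" if "norm x \<le> R" "norm y \<le> R" for x y
    using c0[OF that] mult_right_mono[of c0 c "norm (x - y)"] by (auto simp: c_def)
  have cpos: "0 < c" by (simp add: c_def)
  obtain d where d: "0 < d" and ac: "\<And>D. finite D \<and> (\<forall>(s, t)\<in>D. 0 \<le> s \<and> s \<le> t \<and> t \<le> b) \<and>
     disjoint_family_on (\<lambda>(s, t). {s<..<t}) D \<and> (\<Sum>(s, t)\<in>D. t - s) < d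
     \<longrightarrow> (\<Sum>(s, t)\<in>D. norm (f t - f s)) < e / c"
    using f[unfolded abs_cont_halfline_def, rule_format, of b "e / c"] b e cpos by auto
  have "(\<Sum>(s, t)\<in>D. norm (g (f t) - g (f s))) < e"
    if D: "finite D \<and> (\<forall>(s, t)\<in>D. 0 \<le> s \<and> s \<le> t \<and> t \<le> b) \<and>
     disjoint_family_on (\<lambda>(s, t). {s<..<t}) D \<and> (\<Sum>(s, t)\<in>D. t - s) < d" for D
  proof -
    have "(\<Sum>(s, t)\<in>D. norm (g (f t) - g (f s))) \<le> (\<Sum>(s, t)\<in>D. c * norm (f t - f s))"
    proof (rule sum_mono, clarify)
      fix s t assume "(s, t) \<in> D"
      then have "0 \<le> s \<and> s \<le> t \<and> t \<le> b" using D by auto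
      then show "norm (g (f t) - g (f s)) \<le> c * norm (f t - f s)"
        using c[of "f t" "f s"] R by auto
    qed
    also have "\<dots> = c * (\<Sum>(s, t)\<in>D. norm (f t - f s))"
      by (simp add: sum_distrib_left case_prod_unfold)
    also have "\<dots> < c * (e / c)"
      using ac[rule_format, OF D] cpos by (intro mult_strict_left_mono)
    finally show ?thesis using cpos by simp
  qed
  then show "\<exists>d>0. \<forall>D. finite D \<and> (\<forall>(s, t)\<in>D. 0 \<le> s \<and> s \<le> t \<and> t \<le> b) \<and>
     disjoint_family_on (\<lambda>(s, t). {s<..<t}) D \<and> (\<Sum>(s, t)\<in>D. t - s) < d
     \<longrightarrow> (\<Sum>(s, t)\<in>D. norm (g (f t) - g (f s))) < e"
    using d by (intro exI[of _ d]) simp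
qed

lemma abs_cont_halfline_Vmin:
  assumes "1 \<le> N" "abs_cont_halfline x"
  shows "abs_cont_halfline (\<lambda>t. Vmin N P (x t))"
proof (rule abs_cont_halfline_compose[OF assms(2)])
  fix R :: real
  obtain c where "\<And>x y. \<lbrakk>norm x \<le> R; norm y \<le> R\<rbrakk> \<Longrightarrow> \<bar>Vmin N P x - Vmin N P y\<bar> \<le> c * norm (x - y)"
    using Vmin_lipschitz[OF assms(1), of R P] by blast
  then show "\<exists>c. \<forall>x y. norm x \<le> R \<longrightarrow> norm y \<le> R \<longrightarrow> \<bar>Vmin N P x - Vmin N P y\<bar> \<le> c * norm (x - y)"
    by (intro exI[of _ c]) simp
qed

section \<open>The derivative of the minimum along a solution\<close>

lemma DERIV_quadratic:
  assumes "(x has_vector_derivative x') (at t)"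
  shows "((\<lambda>s. x s \<bullet> (P i *v x s)) has_real_derivative vdot P i (x t) x') (at t)"
proof -
  have "((\<lambda>s. P i *v x s) has_vector_derivative P i *v x') (at t)"
    using bounded_linear.has_vector_derivative[OF matrix_vector_mul_bounded_linear assms] .
  from bounded_bilinear.has_vector_derivative[OF bounded_bilinear_inner assms this]
  show ?thesis
    by (simp add: has_real_derivative_iff_has_vector_derivative vdot_def)
qed

lemma vdot_scaleR: "vdot P i x (c *\<^sub>R y) = c * vdot P i x y"
  by (simp add: vdot_def matrix_vector_mult_scaleR distrib_left)

lemma cl_solution_DERIV_Vmin:
  assumes N: "1 \<le> N" and \<sigma>: "\<sigma> = switch_rule N P"
    and sol: "cl_solution N P \<sigma> A B E K \<psi> x a"
  shows "AE t in lebesgue. t \<in> {0<..} \<longrightarrow> (\<exists>d. ((\<lambda>s. Vmin N P (x s)) has_real_derivative d) (at t) \<and>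
     d \<le> (\<Sum>i\<in>active N \<sigma> (x t). a i t * vdot P i (x t) (xi A B E K \<psi> i (x t) t)))"
proof -
  let ?x' = "\<lambda>t. \<Sum>i\<in>active N \<sigma> (x t). a i t *\<^sub>R xi A B E K \<psi> i (x t) t"
  have ae: "AE t in lebesgue. t \<in> {0<..} \<longrightarrow> (x has_vector_derivative ?x' t) (at t) \<and>
      vdot P (\<sigma> (x t)) (x t) (?x' t)
          \<le> (\<Sum>i\<in>active N \<sigma> (x t). a i t * vdot P i (x t) (xi A B E K \<psi> i (x t) t))"
  proof -
    have "AE t in lebesgue. 0 \<le> t \<longrightarrow>
        (x has_vector_derivative ?x' t) (at t within {0..}) \<and>
        vdot P (\<sigma> (x t)) (x t) (?x' t)
          \<le> (\<Sum>i\<in>active N \<sigma> (x t). vdot P i (x t) (a i t *\<^sub>R xi A B E K \<psi> i (x t) t))"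
      using sol unfolding cl_solution_def by blast
    then show ?thesis
    proof eventually_elim
      case (elim t)
      \<comment> \<open>Away from time zero the one-sided derivative in the solution concept is
        two-sided, as Fermat's criterion requires.\<close>
      have "at t within {0..} = at t" if "0 < t"
        using that by (intro at_within_interior) auto
      with elim show ?case by (auto simp: vdot_scaleR)
    qed
  qed
  have "AE t in lebesgue. t \<in> {0<..} \<longrightarrow> (\<exists>d. ((\<lambda>s. MIN i\<in>{1..N}. x s \<bullet> (P i *v x s)) has_real_derivative d) (at t))"
  proof (rule AE_Min_differentiable)
    fix i
    show "AE t in lebesgue. t \<in> {0<..} \<longrightarrow> (\<exists>d. ((\<lambda>s. x s \<bullet> (P i *v x s)) has_real_derivative d) (at t))"
      using ae by eventually_elim (auto dest: DERIV_quadratic)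
  qed (use N in auto)
  with ae show ?thesis
  proof eventually_elim
    case (elim t)
    show ?case
    proof
      assume t: "t \<in> {0<..}"
      let ?s = "\<sigma> (x t)"
      obtain d where d: "((\<lambda>s. Vmin N P (x s)) has_real_derivative d) (at t)"
        using elim t unfolding Vmin_def by auto
      have "(x has_vector_derivative ?x' t) (at t)" using elim t by blast
      then have "((\<lambda>s. x s \<bullet> (P ?s *v x s)) has_real_derivative vdot P ?s (x t) (?x' t)) (at t)"
        by (rule DERIV_quadratic)
      \<comment> \<open>The mode is frozen at the one selected at time \<open>t\<close> while
        \<open>s\<close> varies: its form stays above the minimum and meets it at
        \<open>s = t\<close>.\<close>
      then have "vdot P ?s (x t) (?x' t) = d"
      proof (rule DERIV_eq_touching_below[OF _ d])
        show "Vmin N P (x s) \<le> x s \<bullet> (P ?s *v x s)" for s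
          unfolding \<sigma> by (rule Vmin_le[OF switch_rule_argmin(1)[OF N]])
        show "Vmin N P (x t) = x t \<bullet> (P ?s *v x t)"
          unfolding \<sigma> by (rule Vmin_switch[OF N])
      qed
      with elim t d show "\<exists>d. ((\<lambda>s. Vmin N P (x s)) has_real_derivative d) (at t) \<and>
        d \<le> (\<Sum>i\<in>active N \<sigma> (x t). a i t * vdot P i (x t) (xi A B E K \<psi> i (x t) t))"
        by auto
    qed
  qed
qed

section \<open>Stability and L2 bounds\<close>

text \<open>Integrating the bound from zero to \<open>n\<close> and dropping the nonnegative final
  value would give the claim, but integrability of \<open>z\<close> is not known beforehand.
  Truncating \<open>z\<close> makes it integrable and only weakens the bound; monotone convergence
  removes the truncation.\<close>

lemma dissipation_imp_L2_bound:
  fixes f p z :: "real \<Rightarrow> real"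
  assumes ac: "abs_cont_halfline f" and f0: "f 0 = 0" and f_nonneg: "\<And>t. 0 \<le> f t"
    and \<kappa>: "0 \<le> \<kappa>" and p_nonneg: "\<And>t. 0 \<le> p t" and z_nonneg: "\<And>t. 0 \<le> z t"
    and p_meas: "(\<lambda>t. indicator {0..} t * p t) \<in> borel_measurable lebesgue"
    and z_meas: "(\<lambda>t. indicator {0..} t * z t) \<in> borel_measurable lebesgue"
    and p_fin: "(\<integral>\<^sup>+t\<in>{0..}. ennreal (p t) \<partial>lebesgue) < \<infinity>"
    and der: "AE t in lebesgue. t \<in> {0<..} \<longrightarrow>
      (\<exists>d. (f has_real_derivative d) (at t) \<and> d \<le> \<kappa> * p t - z t)"
  shows "(\<integral>\<^sup>+t\<in>{0..}. ennreal (z t) \<partial>lebesgue) \<le> ennreal \<kappa> * (\<integral>\<^sup>+t\<in>{0..}. ennreal (p t) \<partial>lebesgue)"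
proof -
  define q where "q t = indicator {0..} t * p t" for t
  define w where "w t = indicator {0..} t * z t" for t
  have q_nonneg: "0 \<le> q t" and w_nonneg: "0 \<le> w t" for t
    using p_nonneg z_nonneg by (auto simp: q_def w_def)
  have [measurable]: "q \<in> borel_measurable lebesgue" "w \<in> borel_measurable lebesgue"
    using p_meas z_meas unfolding q_def w_def by auto
  have q_nn: "(\<integral>\<^sup>+t\<in>{0..}. ennreal (p t) \<partial>lebesgue) = (\<integral>\<^sup>+t. ennreal (q t) \<partial>lebesgue)"
    by (intro nn_integral_cong) (auto simp: q_def split: split_indicator)
  have w_nn: "(\<integral>\<^sup>+t\<in>{0..}. ennreal (z t) \<partial>lebesgue) = (\<integral>\<^sup>+t. ennreal (w t) \<partial>lebesgue)"
    by (intro nn_integral_cong) (auto simp: w_def split: split_indicator)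
  have q_int: "integrable lebesgue q"
    by (rule integrableI_nonneg) (use p_fin q_nn q_nonneg in auto)
  \<comment> \<open>The level and the horizon of the truncation are both \<open>n\<close>, so one
    limit removes both.\<close>
  define g where "g n t = indicator {0..real n} t * min (real n) (w t)" for n t
  have g_nonneg: "0 \<le> g n t" for n t using w_nonneg by (auto simp: g_def)
  have g_meas [measurable]: "g n \<in> borel_measurable lebesgue" for n
    unfolding g_def
    by (intro borel_measurable_times borel_measurable_min borel_measurable_indicator) auto
  have bound: "(\<integral>\<^sup>+t. ennreal (g n t) \<partial>lebesgue) \<le> ennreal \<kappa> * (\<integral>\<^sup>+t. ennreal (q t) \<partial>lebesgue)" for n
  proof -
    define h where "h t = \<kappa> * q t - min (real n) (w t)" for t
    have g_int: "integrable lebesgue (g n)"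
      by (rule integrableI_bounded_set[where A = "{0..real n}" and B = "real n"])
        (use w_nonneg in \<open>auto simp: g_def\<close>)
    have iq_int: "integrable lebesgue (\<lambda>t. indicator {0..real n} t * q t)"
    proof (rule Bochner_Integration.integrable_bound[OF q_int])
      show "(\<lambda>t. indicator {0..real n} t * q t) \<in> borel_measurable lebesgue"
        by (intro borel_measurable_times borel_measurable_indicator) auto
    qed (auto split: split_indicator)
    have h_eq: "indicator {0..real n} t *\<^sub>R h t = \<kappa> * (indicator {0..real n} t * q t) - g n t" for t
      by (auto simp: h_def g_def split: split_indicator)
    have h_int: "set_integrable lebesgue {0..real n} h"
      unfolding set_integrable_def h_eq using g_int iq_int by auto
    have "f (real n) - f 0 \<le> integral {0..real n} h"
    proof (rule abs_cont_halfline_diff_le_integral[OF ac])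
      show "h integrable_on {0..real n}" using set_lebesgue_integral_eq_integral(1)[OF h_int] .
      show "AE t in lebesgue. t \<in> {0<..<real n} \<longrightarrow> (\<exists>d. (f has_real_derivative d) (at t) \<and> d \<le> h t)"
        using der
      proof eventually_elim
        case (elim t)
        show ?case
        proof
          assume t: "t \<in> {0<..<real n}"
          then obtain d where d: "(f has_real_derivative d) (at t)" "d \<le> \<kappa> * p t - z t"
            using elim by auto
          have "d \<le> h t" using d(2) t by (simp add: h_def q_def w_def)
          with d(1) show "\<exists>d. (f has_real_derivative d) (at t) \<and> d \<le> h t" by auto
        qed
      qed
    qed auto
    then have "0 \<le> integral {0..real n} h" using f_nonneg[of "real n"] f0 by simp
    also have "\<dots> = (LINT t|lebesgue. \<kappa> * (indicator {0..real n} t * q t) - g n t)"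
      using set_lebesgue_integral_eq_integral(2)[OF h_int]
      unfolding set_lebesgue_integral_def h_eq by simp
    also have "\<dots> = \<kappa> * (LINT t|lebesgue. indicator {0..real n} t * q t) - (LINT t|lebesgue. g n t)"
      using g_int iq_int by simp
    finally have "(LINT t|lebesgue. g n t) \<le> \<kappa> * (LINT t|lebesgue. indicator {0..real n} t * q t)" by simp
    also have "\<dots> \<le> \<kappa> * (LINT t|lebesgue. q t)"
      using \<kappa> iq_int q_int q_nonneg
      by (intro mult_left_mono integral_mono) (auto split: split_indicator)
    finally have "ennreal (LINT t|lebesgue. g n t) \<le> ennreal (\<kappa> * (LINT t|lebesgue. q t))"
      by (rule ennreal_leI)
    then show ?thesis
      using nn_integral_eq_integral[OF g_int] nn_integral_eq_integral[OF q_int] g_nonneg q_nonneg \<kappa>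
      by (simp add: ennreal_mult)
  qed
  have "(\<lambda>n. \<integral>\<^sup>+t. ennreal (g n t) \<partial>lebesgue) \<longlonglongrightarrow> (\<integral>\<^sup>+t. ennreal (w t) \<partial>lebesgue)"
  proof (rule nn_integral_LIMSEQ)
    show "incseq (\<lambda>n t. ennreal (g n t))"
      by (intro incseq_SucI le_funI ennreal_leI)
        (use w_nonneg in \<open>auto simp: g_def min_def split: split_indicator\<close>)
    fix t
    have "\<forall>\<^sub>F n in sequentially. g n t = w t"
    proof -
      have "\<forall>\<^sub>F n in sequentially. \<bar>t\<bar> + w t \<le> real n"
        using filterlim_real_sequentially unfolding filterlim_at_top by simp
      then show ?thesis
        by eventually_elim (use w_nonneg[of t] in \<open>auto simp: g_def w_def split: split_indicator\<close>)
    qed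
    then have "(\<lambda>n. g n t) \<longlonglongrightarrow> w t" by (rule tendsto_eventually)
    then show "(\<lambda>n. ennreal (g n t)) \<longlonglongrightarrow> ennreal (w t)" by (intro tendsto_ennrealI)
  qed auto
  then have "(\<integral>\<^sup>+t. ennreal (w t) \<partial>lebesgue) \<le> ennreal \<kappa> * (\<integral>\<^sup>+t. ennreal (q t) \<partial>lebesgue)"
    by (rule LIMSEQ_le_const2) (use bound in auto)
  then show ?thesis unfolding q_nn w_nn .
qed

lemma Vmin_coercive:
  fixes P :: "nat \<Rightarrow> real ^ 'n::finite ^ 'n"
  assumes N: "1 \<le> N" and P: "\<And>i. i \<in> {1..N} \<Longrightarrow> fpd UNIV (ent (P i))"
  shows "\<exists>m>0. \<exists>M>0. \<forall>x. m * (norm x)\<^sup>2 \<le> Vmin N P x \<and> Vmin N P x \<le> M * (norm x)\<^sup>2"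
proof -
  have "\<exists>e>0. \<forall>x. e * (norm x)\<^sup>2 \<le> x \<bullet> (P i *v x)" if i: "i \<in> {1..N}" for i
    using fpd_ent_coercive[OF P[OF i]] by metis
  then obtain e where e: "\<And>i. i \<in> {1..N} \<Longrightarrow> 0 < e i"
    "\<And>i x. i \<in> {1..N} \<Longrightarrow> e i * (norm x)\<^sup>2 \<le> x \<bullet> (P i *v x)"
    by metis
  define m where "m = Min (e ` {1..N})"
  have m: "0 < m" unfolding m_def using e(1) N by (subst Min_gr_iff) auto
  have mle: "m * (norm x)\<^sup>2 \<le> x \<bullet> (P i *v x)" if i: "i \<in> {1..N}" for i x
  proof -
    have "m \<le> e i" unfolding m_def using i by (intro Min_le) auto
    then have "m * (norm x)\<^sup>2 \<le> e i * (norm x)\<^sup>2" by (intro mult_right_mono) auto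
    then show ?thesis using e(2)[OF i, of x] by linarith
  qed
  have one: "1 \<in> {1..N}" using N by simp
  \<comment> \<open>For the upper bound a single mode suffices, as the minimum lies below every
    form; adding 1 keeps the constant positive.\<close>
  define M where "M = onorm ((*v) (P 1)) + 1"
  have bl: "bounded_linear ((*v) (P 1))" by (rule matrix_vector_mul_bounded_linear)
  have M: "0 < M" unfolding M_def using onorm_pos_le[OF bl] by linarith
  have "Vmin N P x \<le> M * (norm x)\<^sup>2" for x
  proof -
    have "Vmin N P x \<le> x \<bullet> (P 1 *v x)" using one by (rule Vmin_le)
    also have "\<dots> \<le> norm x * norm (P 1 *v x)" by (rule norm_cauchy_schwarz)
    also have "\<dots> \<le> norm x * (onorm ((*v) (P 1)) * norm x)"
      by (intro mult_left_mono onorm[OF bl]) auto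
    also have "\<dots> \<le> M * (norm x)\<^sup>2"
      by (simp add: M_def power2_eq_square algebra_simps)
    finally show ?thesis .
  qed
  moreover have "m * (norm x)\<^sup>2 \<le> Vmin N P x" for x
    unfolding Vmin_switch[OF N] by (rule mle[OF switch_rule_argmin(1)[OF N]])
  ultimately show ?thesis using m M by auto
qed

lemma weighted_sum_le:
  fixes a g :: "'i \<Rightarrow> real"
  assumes "\<And>i. i \<in> I \<Longrightarrow> 0 \<le> a i" "(\<Sum>i\<in>I. a i) = 1" "\<And>i. i \<in> I \<Longrightarrow> g i \<le> c"
  shows "(\<Sum>i\<in>I. a i * g i) \<le> c"
proof -
  have "(\<Sum>i\<in>I. a i * g i) \<le> (\<Sum>i\<in>I. a i * c)"
    using assms by (intro sum_mono mult_left_mono) auto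
  also have "\<dots> = c" using assms(2) by (simp flip: sum_distrib_right)
  finally show ?thesis .
qed

text \<open>Jensen's inequality for the squared norm, from the nonnegative weighted variance about
  the mean \<open>s\<close>. It passes from the outputs of the modes to the modified output.\<close>

lemma norm_weighted_sum_squared_le:
  fixes z :: "'i \<Rightarrow> 'a::real_inner"
  assumes "\<And>i. i \<in> I \<Longrightarrow> 0 \<le> a i" "(\<Sum>i\<in>I. a i) = 1"
  shows "(norm (\<Sum>i\<in>I. a i *\<^sub>R z i))\<^sup>2 \<le> (\<Sum>i\<in>I. a i * (norm (z i))\<^sup>2)"
proof -
  define s where "s = (\<Sum>i\<in>I. a i *\<^sub>R z i)"
  have "0 \<le> (\<Sum>i\<in>I. a i * (norm (z i - s))\<^sup>2)"
    using assms(1) by (intro sum_nonneg) auto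
  also have "\<dots> = (\<Sum>i\<in>I. a i * (norm (z i))\<^sup>2 - 2 * ((a i *\<^sub>R z i) \<bullet> s) + a i * (norm s)\<^sup>2)"
    unfolding power2_norm_eq_inner
    by (intro sum.cong refl) (simp add: inner_diff_left inner_diff_right inner_commute algebra_simps)
  also have "\<dots> = (\<Sum>i\<in>I. a i * (norm (z i))\<^sup>2) - 2 * (s \<bullet> s) + (norm s)\<^sup>2"
    unfolding sum.distrib sum_subtractf
    using assms(2) by (simp add: s_def inner_sum_left flip: sum_distrib_left sum_distrib_right)
  finally show ?thesis by (simp add: s_def power2_norm_eq_inner)
qed

text \<open>No exponential estimate is needed. As the minimum is nonincreasing, its derivative on
  the interval from 0 to \<open>t\<close> is at most the constant \<open>- (c / M)\<close> times its
  final value; integrating gives decay of order \<open>1 / t\<close>, enough for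
  convergence.\<close>

lemma glob_asym_stable_if_decrease:
  fixes P :: "nat \<Rightarrow> real ^ 'n::finite ^ 'n" and E :: "nat \<Rightarrow> real ^ 'q::finite ^ 'n"
  assumes N: "1 \<le> N" and \<sigma>: "\<sigma> = switch_rule N P"
    and P: "\<And>i. i \<in> {1..N} \<Longrightarrow> fpd UNIV (ent (P i))"
    and c: "0 < c"
    and dec: "\<And>i x. i \<in> active N \<sigma> x \<Longrightarrow> vdot P i x ((A i + B i ** K i) *v x) \<le> - c * (norm x)\<^sup>2"
  shows "glob_asym_stable N P \<sigma> A B E K"
proof -
  obtain m M where mM: "0 < m" "0 < M" "\<And>x. m * (norm x)\<^sup>2 \<le> Vmin N P x" "\<And>x. Vmin N P x \<le> M * (norm x)\<^sup>2"
    using Vmin_coercive[of N P, OF N P] by auto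
  have mono: "Vmin N P (x t) \<le> Vmin N P (x s)" (is ?mono)
    and decay: "Vmin N P (x t) * (c / M * t) \<le> Vmin N P (x 0)" (is ?decay)
    if sol: "cl_solution N P \<sigma> A B E K (\<lambda>t. 0) x a" and st: "0 \<le> s" "s \<le> t" for x a s t
  proof -
    let ?f = "\<lambda>t. Vmin N P (x t)"
    have ac: "abs_cont_halfline ?f"
      using sol by (intro abs_cont_halfline_Vmin[OF N]) (auto simp: cl_solution_def)
    have w: "\<And>t i. 0 \<le> t \<Longrightarrow> i \<in> active N \<sigma> (x t) \<Longrightarrow> 0 \<le> a i t"
      "\<And>t. 0 \<le> t \<Longrightarrow> (\<Sum>i\<in>active N \<sigma> (x t). a i t) = 1"
      using sol by (auto simp: cl_solution_def)
    have der: "AE t in lebesgue. t \<in> {0<..} \<longrightarrow> (\<exists>d. (?f has_real_derivative d) (at t) \<and> d \<le> - c * (norm (x t))\<^sup>2)"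
      using cl_solution_DERIV_Vmin[OF N \<sigma> sol]
    proof eventually_elim
      case (elim t)
      show ?case
      proof
        assume t: "t \<in> {0<..}"
        then obtain d where d: "(?f has_real_derivative d) (at t)"
          "d \<le> (\<Sum>i\<in>active N \<sigma> (x t). a i t * vdot P i (x t) (xi A B E K (\<lambda>t. 0) i (x t) t))"
          using elim by auto
        have "(\<Sum>i\<in>active N \<sigma> (x t). a i t * vdot P i (x t) (xi A B E K (\<lambda>t. 0) i (x t) t)) \<le> - c * (norm (x t))\<^sup>2"
          by (rule weighted_sum_le) (use t w dec in \<open>auto simp: xi_def\<close>)
        with d show "\<exists>d. (?f has_real_derivative d) (at t) \<and> d \<le> - c * (norm (x t))\<^sup>2"
          by (intro exI[of _ d]) auto
      qed
    qed
    have mono: "?f v \<le> ?f u" if uv: "0 \<le> u" "u \<le> v" for u v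
    proof -
      have "?f v - ?f u \<le> integral {u..v} (\<lambda>_. 0)"
      proof (rule abs_cont_halfline_diff_le_integral[OF ac uv])
        show "AE t in lebesgue. t \<in> {u<..<v} \<longrightarrow> (\<exists>d. (?f has_real_derivative d) (at t) \<and> d \<le> 0)"
          using der
        proof eventually_elim
          case (elim t)
          have "- c * (norm (x t))\<^sup>2 \<le> 0" using c by simp
          with elim uv show ?case by force
        qed
      qed auto
      then show ?thesis by simp
    qed
    then show "?f t \<le> ?f s" using st .
    have t: "0 \<le> t" using st by simp
    have "?f t - ?f 0 \<le> integral {0..t} (\<lambda>_. - (c / M * ?f t))"
    proof (rule abs_cont_halfline_diff_le_integral[OF ac _ t])
      show "AE r in lebesgue. r \<in> {0<..<t} \<longrightarrow> (\<exists>d. (?f has_real_derivative d) (at r) \<and> d \<le> - (c / M * ?f t))"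
        using der
      proof eventually_elim
        case (elim r)
        have "- c * (norm (x r))\<^sup>2 \<le> - (c / M * ?f t)" if "r \<in> {0<..<t}"
        proof -
          have "?f t \<le> M * (norm (x r))\<^sup>2" using mono[of r t] that mM(4)[of "x r"] by simp
          then have "c / M * ?f t \<le> c / M * (M * (norm (x r))\<^sup>2)"
            using c mM(2) by (intro mult_left_mono) auto
          then show ?thesis using mM(2) by simp
        qed
        with elim show ?case by force
      qed
    qed auto
    also have "\<dots> = - (?f t * (c / M * t))" using t by simp
    finally have "?f t * (c / M * t) + ?f t \<le> ?f 0" by simp
    moreover have "0 \<le> ?f t" using mM(1) mM(3)[of "x t"] by (meson less_imp_le mult_nonneg_nonneg order_trans zero_le_power2)
    ultimately show "?f t * (c / M * t) \<le> ?f 0" by linarith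
  qed
  show ?thesis
    unfolding glob_asym_stable_def
  proof (intro conjI allI impI)
    fix \<epsilon> :: real assume \<epsilon>: "0 < \<epsilon>"
    \<comment> \<open>Chosen so that the upper bound \<open>M * \<delta>\<^sup>2\<close> at time
      zero equals the lower bound \<open>m * \<epsilon>\<^sup>2\<close> to be beaten.\<close>
    define \<delta> where "\<delta> = \<epsilon> * sqrt (m / M)"
    have \<delta>: "0 < \<delta>" "M * \<delta>\<^sup>2 = m * \<epsilon>\<^sup>2"
      using \<epsilon> mM(1,2) by (auto simp: \<delta>_def power_mult_distrib)
    have "norm (x t) < \<epsilon>" if sol: "cl_solution N P \<sigma> A B E K (\<lambda>t. 0) x a" "norm (x 0) < \<delta>" and t: "0 \<le> t" for x a t
    proof -
      have "m * (norm (x t))\<^sup>2 \<le> Vmin N P (x t)" by (rule mM)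
      also have "\<dots> \<le> Vmin N P (x 0)" using mono[OF sol(1) _ t] by simp
      also have "\<dots> \<le> M * (norm (x 0))\<^sup>2" by (rule mM)
      also have "\<dots> < M * \<delta>\<^sup>2" using sol(2) mM(2) by (intro mult_strict_left_mono power_strict_mono) auto
      finally have "(norm (x t))\<^sup>2 < \<epsilon>\<^sup>2" using \<delta>(2) mM(1) by simp
      then show ?thesis using \<epsilon> by (simp add: power2_less_imp_less)
    qed
    then show "\<exists>\<delta>>0. \<forall>x a. cl_solution N P \<sigma> A B E K (\<lambda>t. 0) x a \<and> norm (x 0) < \<delta>
        \<longrightarrow> (\<forall>t\<ge>0. norm (x t) < \<epsilon>)"
      using \<delta>(1) by (intro exI[of _ \<delta>]) auto
  next
    fix x a assume sol: "cl_solution N P \<sigma> A B E K (\<lambda>t. 0) x a"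
    define k where "k = Vmin N P (x 0) / (m * (c / M))"
    have le: "(norm (x t))\<^sup>2 \<le> k / t" if t: "0 < t" for t
    proof -
      have "m * (norm (x t))\<^sup>2 * (c / M * t) \<le> Vmin N P (x t) * (c / M * t)"
        using mM c t by (intro mult_right_mono) auto
      also have "\<dots> \<le> Vmin N P (x 0)" using decay[OF sol, of 0 t] t by simp
      finally show ?thesis using mM(1,2) c t by (simp add: k_def field_simps)
    qed
    have "((\<lambda>t. (norm (x t))\<^sup>2) \<longlongrightarrow> 0) at_top"
    proof (rule tendsto_sandwich[of "\<lambda>_. 0" _ _ "\<lambda>t. k / t"])
      show "((\<lambda>t. k / t) \<longlongrightarrow> 0) at_top"
        by (intro real_tendsto_divide_at_top[of _ k] tendsto_const filterlim_ident)
      show "\<forall>\<^sub>F t in at_top. (norm (x t))\<^sup>2 \<le> k / t"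
        using eventually_gt_at_top[of 0] by eventually_elim (rule le)
    qed auto
    then have "((\<lambda>t. sqrt ((norm (x t))\<^sup>2)) \<longlongrightarrow> sqrt 0) at_top" by (intro tendsto_real_sqrt)
    then show "(x \<longlongrightarrow> 0) at_top" by (simp add: tendsto_norm_zero_iff)
  qed
qed

section \<open>Measurability of the modified output and the gain bound\<close>

lemma borel_measurable_matrix_vector_mult:
  fixes M :: "real ^ 'a::finite ^ 'b::finite"
  assumes "f \<in> borel_measurable L"
  shows "(\<lambda>t. M *v f t) \<in> borel_measurable L"
  using assms
  by (rule measurable_compose)
    (intro borel_measurable_continuous_onI linear_continuous_on matrix_vector_mul_bounded_linear)

text \<open>The index set of the sum varies with time. Summing over all modes, with each weight cut
  off to the times where its mode is active, yields exactly the functions whose measurability the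
  solution concept provides.\<close>

lemma output_a_measurable:
  fixes C :: "nat \<Rightarrow> real ^ 'n::finite ^ 'p::finite"
  assumes sol: "cl_solution N P \<sigma> A B E K \<psi> x a" and \<psi>: "set_borel_measurable lebesgue {0..} \<psi>"
  shows "(\<lambda>t. indicator {0..} t *\<^sub>R output_a N \<sigma> C D F K \<psi> x a t) \<in> borel_measurable lebesgue"
proof -
  define S where "S i = {t. 0 \<le> t \<and> i \<in> active N \<sigma> (x t)}" for i
  have "continuous_on {0..} x"
    using sol by (intro abs_cont_halfline_imp_continuous) (auto simp: cl_solution_def)
  then have "(\<lambda>t. indicator {0..} t *\<^sub>R x t) \<in> borel_measurable lborel"
    using borel_measurable_continuous_on_indicator[of "{0..}" x] by simp
  then have x: "(\<lambda>t. indicator {0..} t *\<^sub>R x t) \<in> borel_measurable lebesgue"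
    by (rule measurable_completion)
  have a: "(\<lambda>t. indicator (S i) t *\<^sub>R a i t) \<in> borel_measurable lebesgue" if "i \<in> {1..N}" for i
    using sol that unfolding cl_solution_def S_def set_borel_measurable_def by blast
  have eq: "indicator {0..} t *\<^sub>R output_a N \<sigma> C D F K \<psi> x a t = (\<Sum>i\<in>{1..N}. (indicator (S i) t *\<^sub>R a i t) *\<^sub>R
      ((C i + D i ** K i) *v (indicator {0..} t *\<^sub>R x t) + F i *v (indicator {0..} t *\<^sub>R \<psi> t)))" for t
  proof (cases "0 \<le> t")
    case True
    have "output_a N \<sigma> C D F K \<psi> x a t
       = (\<Sum>i\<in>{1..N}. if i \<in> active N \<sigma> (x t) then a i t *\<^sub>R ((C i + D i ** K i) *v x t + F i *v \<psi> t) else 0)"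
      unfolding output_a_def by (intro sum.mono_neutral_cong_left) (auto simp: active_def)
    also have "\<dots> = (\<Sum>i\<in>{1..N}. (indicator (S i) t *\<^sub>R a i t) *\<^sub>R
      ((C i + D i ** K i) *v (indicator {0..} t *\<^sub>R x t) + F i *v (indicator {0..} t *\<^sub>R \<psi> t)))"
      using True by (intro sum.cong) (auto simp: S_def)
    finally show ?thesis using True by simp
  qed (simp add: S_def)
  show ?thesis
    unfolding eq
    by (rule borel_measurable_sum, rule borel_measurable_scaleR[OF a borel_measurable_add[OF
        borel_measurable_matrix_vector_mult[OF x]
        borel_measurable_matrix_vector_mult[OF \<psi>[unfolded set_borel_measurable_def]]]])
qed

lemma J_inf_le_if_dissipative:
  fixes P :: "nat \<Rightarrow> real ^ 'n::finite ^ 'n" and E :: "nat \<Rightarrow> real ^ 'q::finite ^ 'n"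
    and C :: "nat \<Rightarrow> real ^ 'n ^ 'p::finite"
  assumes N: "1 \<le> N" and \<sigma>: "\<sigma> = switch_rule N P"
    and P: "\<And>i. i \<in> {1..N} \<Longrightarrow> fpd UNIV (ent (P i))"
    and \<kappa>: "0 \<le> \<kappa>"
    and dis: "\<And>i x u. i \<in> active N \<sigma> x \<Longrightarrow> vdot P i x ((A i + B i ** K i) *v x + E i *v u)
      + (norm ((C i + D i ** K i) *v x + F i *v u))\<^sup>2 \<le> \<kappa> * (norm u)\<^sup>2"
  shows "J_inf N P \<sigma> A B C D E F K \<le> ennreal \<kappa>"
  unfolding J_inf_def
proof (rule Sup_least, clarify)
  fix \<psi> x a
  assume \<psi>: "\<psi> \<in> L2_signals" "sq_L2_norm \<psi> \<noteq> 0"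
    and sol: "cl_solution N P \<sigma> A B E K \<psi> x a" and x0: "x 0 = 0"
  let ?z = "output_a N \<sigma> C D F K \<psi> x a"
  have w: "\<And>t i. 0 \<le> t \<Longrightarrow> i \<in> active N \<sigma> (x t) \<Longrightarrow> 0 \<le> a i t"
    "\<And>t. 0 \<le> t \<Longrightarrow> (\<Sum>i\<in>active N \<sigma> (x t). a i t) = 1"
    using sol by (auto simp: cl_solution_def)
  have \<psi>_meas: "set_borel_measurable lebesgue {0..} \<psi>" and \<psi>_fin: "sq_L2_norm \<psi> < \<infinity>"
    using \<psi>(1) by (auto simp: L2_signals_def)
  have sq: "indicator {0..} t * (s t \<bullet> s t) = (indicator {0..} t *\<^sub>R s t) \<bullet> (indicator {0..} t *\<^sub>R s t)"
    for s :: "real \<Rightarrow> real ^ 'd::finite" and t :: real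
    by (simp split: split_indicator)
  have "sq_L2_norm ?z \<le> ennreal \<kappa> * sq_L2_norm \<psi>"
    unfolding sq_L2_norm_def
  proof (rule dissipation_imp_L2_bound)
    show "abs_cont_halfline (\<lambda>t. Vmin N P (x t))"
      using sol by (intro abs_cont_halfline_Vmin[OF N]) (auto simp: cl_solution_def)
    show "Vmin N P (x 0) = 0" by (simp add: x0 Vmin_switch[OF N])
    obtain m where m: "0 < m" "\<And>y. m * (norm y)\<^sup>2 \<le> Vmin N P y"
      using Vmin_coercive[of N P, OF N P] by auto
    show "0 \<le> Vmin N P (x t)" for t
      using m(1) m(2)[of "x t"] by (meson less_imp_le mult_nonneg_nonneg order_trans zero_le_power2)
    show "(\<lambda>t. indicator {0..} t * (\<psi> t \<bullet> \<psi> t)) \<in> borel_measurable lebesgue"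
      unfolding sq using \<psi>_meas by (intro borel_measurable_inner) (auto simp: set_borel_measurable_def)
    show "(\<lambda>t. indicator {0..} t * (?z t \<bullet> ?z t)) \<in> borel_measurable lebesgue"
      unfolding sq by (intro borel_measurable_inner output_a_measurable[OF sol \<psi>_meas])
    show "(\<integral>\<^sup>+t\<in>{0..}. ennreal (\<psi> t \<bullet> \<psi> t) \<partial>lebesgue) < \<infinity>"
      using \<psi>_fin by (simp add: sq_L2_norm_def)
    show "AE t in lebesgue. t \<in> {0<..} \<longrightarrow> (\<exists>d. ((\<lambda>s. Vmin N P (x s)) has_real_derivative d) (at t) \<and>
        d \<le> \<kappa> * (\<psi> t \<bullet> \<psi> t) - ?z t \<bullet> ?z t)"
      using cl_solution_DERIV_Vmin[OF N \<sigma> sol]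
    proof eventually_elim
      case (elim t)
      show ?case
      proof
        assume t: "t \<in> {0<..}"
        let ?I = "active N \<sigma> (x t)"
        let ?zi = "\<lambda>i. (C i + D i ** K i) *v x t + F i *v \<psi> t"
        let ?vi = "\<lambda>i. vdot P i (x t) (xi A B E K \<psi> i (x t) t)"
        obtain d where d: "((\<lambda>s. Vmin N P (x s)) has_real_derivative d) (at t)"
          "d \<le> (\<Sum>i\<in>?I. a i t * ?vi i)"
          using elim t by auto
        \<comment> \<open>The disturbance is common to all modes, so averaging the dissipation
          inequalities of the modes leaves the supply term unchanged.\<close>
        have "(\<Sum>i\<in>?I. a i t * (?vi i + (norm (?zi i))\<^sup>2)) \<le> \<kappa> * (norm (\<psi> t))\<^sup>2"
          by (rule weighted_sum_le) (use t w dis in \<open>auto simp: xi_def\<close>)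
        moreover have "(norm (?z t))\<^sup>2 \<le> (\<Sum>i\<in>?I. a i t * (norm (?zi i))\<^sup>2)"
          unfolding output_a_def by (rule norm_weighted_sum_squared_le) (use t w in auto)
        ultimately have "d \<le> \<kappa> * (\<psi> t \<bullet> \<psi> t) - ?z t \<bullet> ?z t"
          using d(2) by (simp add: distrib_left sum.distrib power2_norm_eq_inner)
        with d(1) show "\<exists>d. ((\<lambda>s. Vmin N P (x s)) has_real_derivative d) (at t) \<and>
            d \<le> \<kappa> * (\<psi> t \<bullet> \<psi> t) - ?z t \<bullet> ?z t"
          by auto
      qed
    qed
  qed (use \<kappa> in auto)
  then show "sq_L2_norm ?z / sq_L2_norm \<psi> \<le> ennreal \<kappa>"
    using \<psi>(2) by (intro divide_le_posI_ennreal) (auto simp: mult.commute zero_less_iff_neq_zero)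
qed

lemma vdot_sym:
  assumes "transpose (P i) = P i"
  shows "vdot P i x y = 2 * ((P i *v x) \<bullet> y)"
  using inner_sym_matrix[OF assms, of x y] inner_sym_matrix[OF assms, of y x]
  by (simp add: vdot_def inner_commute)

text \<open>The least of finitely many constants works for all modes because \<open>Q\<close>
  survives shrinking. The cap \<open>b\<close> bounds the result and keeps the minimum meaningful
  when there are no modes.\<close>

lemma uniform_positive_constant:
  fixes Q :: "nat \<Rightarrow> real \<Rightarrow> bool"
  assumes "\<And>i. i \<in> {1..N} \<Longrightarrow> \<exists>e>0. Q i e" "\<And>i e e'. Q i e \<Longrightarrow> 0 < e' \<Longrightarrow> e' \<le> e \<Longrightarrow> Q i e'" "0 < b"
  shows "\<exists>e>0. e \<le> b \<and> (\<forall>i\<in>{1..N}. Q i e)"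
proof -
  have "\<forall>i\<in>{1..N}. \<exists>e>0. Q i e" using assms(1) by blast
  then obtain e where e: "\<And>i. i \<in> {1..N} \<Longrightarrow> 0 < e i \<and> Q i (e i)" by metis
  define m where "m = Min (insert b (e ` {1..N}))"
  have "0 < m" unfolding m_def using e assms(3) by (subst Min_gr_iff) auto
  moreover have "m \<le> b" unfolding m_def by (intro Min_le) auto
  moreover have "Q i m" if "i \<in> {1..N}" for i
  proof -
    have "m \<le> e i" unfolding m_def using that by (intro Min_le) auto
    then show ?thesis using assms(2) e[OF that] \<open>0 < m\<close> by auto
  qed
  ultimately show ?thesis by auto
qed

theorem theorem4:
  fixes N :: nat and T :: "nat \<Rightarrow> nat"
    and Abar :: "nat \<Rightarrow> real ^ 'n::finite ^ 'n" and Bbar :: "nat \<Rightarrow> real ^ 'm::finite ^ 'n"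
    and C :: "nat \<Rightarrow> real ^ 'n ^ 'p::finite" and D :: "nat \<Rightarrow> real ^ 'm ^ 'p"
    and E :: "nat \<Rightarrow> real ^ 'q::finite ^ 'n" and F :: "nat \<Rightarrow> real ^ 'q ^ 'p"
    and X Xd Wbar :: "nat \<Rightarrow> ('n, nat) fmat" and U :: "nat \<Rightarrow> ('m, nat) fmat"
    and \<Phi> :: "nat \<Rightarrow> ('n + nat, 'n + nat) fmat"
    and P Y :: "nat \<Rightarrow> real ^ 'n ^ 'n" and L K :: "nat \<Rightarrow> real ^ 'n ^ 'm"
    and \<alpha> :: "nat \<Rightarrow> real" and \<pi> :: "nat \<Rightarrow> nat \<Rightarrow> real" and \<rho> :: real
    and \<sigma> :: "real ^ 'n \<Rightarrow> nat"
  assumes "1 \<le> N"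
    and \<Phi>_sym: "\<And>i. i \<in> {1..N} \<Longrightarrow> fsym (UNIV <+> {1..T i}) (\<Phi> i)"
    and \<Phi>22: "\<And>i. i \<in> {1..N} \<Longrightarrow> fnd {1..T i} (block22 (\<Phi> i))"
    and noise: "\<And>i. i \<in> {1..N} \<Longrightarrow> Wbar i \<in> noise_set (T i) (\<Phi> i)"
    and data: "\<And>i. i \<in> {1..N} \<Longrightarrow> fmat_eq_on UNIV {1..T i} (Xd i)
                 (ent (Abar i) \<odot>\<^bsub>UNIV\<^esub> X i + ent (Bbar i) \<odot>\<^bsub>UNIV\<^esub> U i + Wbar i)"
    and P_pos: "\<And>i. i \<in> {1..N} \<Longrightarrow> fpd UNIV (ent (P i))"
    and \<alpha>_nonneg: "\<And>i. i \<in> {1..N} \<Longrightarrow> 0 \<le> \<alpha> i"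
    and Y_pos: "\<And>i. i \<in> {1..N} \<Longrightarrow> fpd UNIV (ent (Y i))"
    and \<Pi>: "\<pi> \<in> Mplus N"
    and \<rho>_pos: "0 < \<rho>"
    and lmi1: "\<And>i. i \<in> {1..N} \<Longrightarrow>
      fpsd (others N i <+> UNIV <+> UNIV <+> UNIV)
        (lmi_stab N P \<pi> (Y i) (L i) i
          - \<alpha> i *\<^sub>f (Gam (Xd i) (X i) (U i) \<odot>\<^bsub>UNIV <+> {1..T i}\<^esub>
                    (\<Phi> i \<odot>\<^bsub>UNIV <+> {1..T i}\<^esub> ftr (Gam (Xd i) (X i) (U i)))))"
    and lmi2: "\<And>i. i \<in> {1..N} \<Longrightarrow>
      fpd UNIV (lmi_perf (Y i) (E i) (F i) (C i ** matrix_inv (P i) + D i ** L i) \<rho>)"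
    and \<sigma>: "\<sigma> = switch_rule N P"
    and K: "K = (\<lambda>i. L i ** P i)"
  shows "glob_asym_stable N P \<sigma> Abar Bbar E K \<and>
         J_inf N P \<sigma> Abar Bbar C D E F K < ennreal \<rho>"
proof -
  note N = \<open>1 \<le> N\<close>
  have act: "i \<in> {1..N}" if "i \<in> active N \<sigma> x" for i x
    using that by (simp add: active_def)
  have vdot: "vdot P i x y = 2 * ((P i *v x) \<bullet> y)" if "i \<in> {1..N}" for i x y
    using P_pos[OF that] by (intro vdot_sym fpd_ent_sym)
  have dec: "2 * ((P i *v x) \<bullet> ((Abar i + Bbar i ** K i) *v x)) \<le> - ((P i *v x) \<bullet> (Y i *v (P i *v x)))"
    if i: "i \<in> active N \<sigma> x" for i x
  proof -
    note iN = act[OF i]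
    have \<pi>: "0 < \<pi> j i" if "j \<in> {1..N} - {i}" for j
      using \<Pi> iN that by (auto simp: Mplus_def)
    have "2 * ((P i *v x) \<bullet> ((Abar i + Bbar i ** (L i ** P i)) *v x))
      \<le> - (\<Sum>j=1..N. \<pi> j i * (x \<bullet> (P j *v x))) - (P i *v x) \<bullet> (Y i *v (P i *v x))"
      by (rule lmi_stab_imp_decrease[OF iN noise[OF iN] data[OF iN] P_pos \<alpha>_nonneg[OF iN] \<pi> lmi1[OF iN]])
    moreover have "0 \<le> (\<Sum>j=1..N. \<pi> j i * (x \<bullet> (P j *v x)))"
    proof -
      \<comment> \<open>The vanishing column sum allows the same value of form \<open>i\<close> to
        be subtracted in every term, leaving differences that are nonnegative by optimality.\<close>
      have "0 = (\<Sum>j=1..N. \<pi> j i) * (x \<bullet> (P i *v x))"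
        using \<Pi> iN by (simp add: Mplus_def)
      also have "\<dots> = (\<Sum>j=1..N. \<pi> j i * (x \<bullet> (P i *v x)))" by (rule sum_distrib_right)
      also have "\<dots> \<le> (\<Sum>j=1..N. \<pi> j i * (x \<bullet> (P j *v x)))"
      proof (rule sum_mono)
        fix j assume j: "j \<in> {1..N}"
        show "\<pi> j i * (x \<bullet> (P i *v x)) \<le> \<pi> j i * (x \<bullet> (P j *v x))"
        \<comment> \<open>The sign of the diagonal entry is not prescribed, but for
          \<open>j = i\<close> both sides coincide.\<close>
        proof (cases "j = i")
          case False
          then show ?thesis
            using \<pi>[of j] j active_argmin[OF N i[unfolded \<sigma>] j] by (intro mult_left_mono) auto
        qed simp
      qed
      finally show ?thesis .
    qed
    ultimately show ?thesis by (simp add: K)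
  qed
  have "\<exists>c>0. \<forall>x. c * (norm x)\<^sup>2 \<le> (P i *v x) \<bullet> (Y i *v (P i *v x))" if i: "i \<in> {1..N}" for i
  proof -
    obtain p where p: "0 < p" "\<And>x. p * (norm x)\<^sup>2 \<le> x \<bullet> (P i *v x)"
      using fpd_ent_coercive[OF P_pos[OF i]] by metis
    obtain y where y: "0 < y" "\<And>x. y * (norm x)\<^sup>2 \<le> x \<bullet> (Y i *v x)"
      using fpd_ent_coercive[OF Y_pos[OF i]] by metis
    \<comment> \<open>Coercivity of \<open>Y i\<close> is applied at \<open>P i *v x\<close>, whose
      norm is at least \<open>p\<close> times that of \<open>x\<close> by Cauchy-Schwarz; hence the
      factor \<open>y * p\<^sup>2\<close>.\<close>
    have "y * p\<^sup>2 * (norm x)\<^sup>2 \<le> (P i *v x) \<bullet> (Y i *v (P i *v x))" for x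
    proof -
      have "p * norm x \<le> norm (P i *v x)"
      proof (cases "x = 0")
        case False
        have "norm x * (p * norm x) \<le> norm x * norm (P i *v x)"
          using p(2)[of x] norm_cauchy_schwarz[of x "P i *v x"] by (simp add: power2_eq_square mult_ac)
        then show ?thesis using False by simp
      qed simp
      then have "(p * norm x)\<^sup>2 \<le> (norm (P i *v x))\<^sup>2" using p(1) by (intro power_mono) auto
      then have "y * (p * norm x)\<^sup>2 \<le> y * (norm (P i *v x))\<^sup>2" using y(1) by simp
      then show ?thesis using y(2)[of "P i *v x"] by (simp add: power_mult_distrib mult_ac)
    qed
    then show ?thesis using y(1) p(1) by (intro exI[of _ "y * p\<^sup>2"]) auto
  qed
  then have "\<exists>c>0. c \<le> 1 \<and> (\<forall>i\<in>{1..N}. \<forall>x. c * (norm x)\<^sup>2 \<le> (P i *v x) \<bullet> (Y i *v (P i *v x)))"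
  proof (rule uniform_positive_constant)
    fix i and e e' :: real
    assume *: "\<forall>x. e * (norm x)\<^sup>2 \<le> (P i *v x) \<bullet> (Y i *v (P i *v x))" "e' \<le> e"
    show "\<forall>x. e' * (norm x)\<^sup>2 \<le> (P i *v x) \<bullet> (Y i *v (P i *v x))"
    proof
      fix x :: "real ^ 'n"
      have "e' * (norm x)\<^sup>2 \<le> e * (norm x)\<^sup>2" using *(2) by (intro mult_right_mono) auto
      then show "e' * (norm x)\<^sup>2 \<le> (P i *v x) \<bullet> (Y i *v (P i *v x))"
        using *(1)[rule_format, of x] by linarith
    qed
  qed auto
  then obtain c where c: "0 < c"
    "\<And>i x. i \<in> {1..N} \<Longrightarrow> c * (norm x)\<^sup>2 \<le> (P i *v x) \<bullet> (Y i *v (P i *v x))"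
    by auto
  have "glob_asym_stable N P \<sigma> Abar Bbar E K"
  proof (rule glob_asym_stable_if_decrease[OF N \<sigma> P_pos c(1)])
    fix i x assume i: "i \<in> active N \<sigma> x"
    show "vdot P i x ((Abar i + Bbar i ** K i) *v x) \<le> - c * (norm x)\<^sup>2"
      using dec[OF i] c(2)[OF act[OF i], of x] vdot[OF act[OF i]] by simp
  qed
  moreover have "J_inf N P \<sigma> Abar Bbar C D E F K < ennreal \<rho>"
  proof -
    let ?G = "\<lambda>i. C i ** matrix_inv (P i) + D i ** L i"
    let ?Q = "\<lambda>i e. \<forall>y u. - (y \<bullet> (Y i *v y)) + 2 * (y \<bullet> (E i *v u)) + (norm (?G i *v y + F i *v u))\<^sup>2
      \<le> (\<rho> - e) * (norm u)\<^sup>2"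
    \<comment> \<open>The cap \<rho> keeps \<open>\<rho> - e\<close> nonnegative, as a gain constant
      must be.\<close>
    have "\<exists>e>0. e \<le> \<rho> \<and> (\<forall>i\<in>{1..N}. ?Q i e)"
    proof (rule uniform_positive_constant[OF _ _ \<rho>_pos])
      show "\<exists>e>0. ?Q i e" if "i \<in> {1..N}" for i
        using lmi_perf_imp_dissipation[OF lmi2[OF that]] by metis
      show "?Q i e'" if "?Q i e" "0 < e'" "e' \<le> e" for i e e'
      proof (intro allI)
        fix y :: "real ^ 'n" and u :: "real ^ 'q"
        have "(\<rho> - e) * (norm u)\<^sup>2 \<le> (\<rho> - e') * (norm u)\<^sup>2" using that(3) by (intro mult_right_mono) auto
        then show "- (y \<bullet> (Y i *v y)) + 2 * (y \<bullet> (E i *v u)) + (norm (?G i *v y + F i *v u))\<^sup>2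
          \<le> (\<rho> - e') * (norm u)\<^sup>2"
          using that(1)[rule_format, of y u] by linarith
      qed
    qed
    then obtain e where e: "0 < e" "e \<le> \<rho>" "\<And>i. i \<in> {1..N} \<Longrightarrow> ?Q i e" by auto
    have "J_inf N P \<sigma> Abar Bbar C D E F K \<le> ennreal (\<rho> - e)"
    proof (rule J_inf_le_if_dissipative[OF N \<sigma> P_pos])
      fix i x u assume i: "i \<in> active N \<sigma> x"
      note iN = act[OF i]
      \<comment> \<open>The second inequality is stated in the variable \<open>P i *v x\<close>;
        cancelling the inverse turns its output block into the closed-loop output matrix, since
        \<open>K i = L i ** P i\<close>.\<close>
      have "?G i *v (P i *v x) = (C i + D i ** K i) *v x"
        using matrix_inv_cancel(2)[OF P_pos[OF iN], of x]
        by (simp add: K matrix_vector_mult_add_rdistrib flip: matrix_vector_mul_assoc)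
      then have "- ((P i *v x) \<bullet> (Y i *v (P i *v x))) + 2 * ((P i *v x) \<bullet> (E i *v u))
          + (norm ((C i + D i ** K i) *v x + F i *v u))\<^sup>2 \<le> (\<rho> - e) * (norm u)\<^sup>2"
        using e(3)[OF iN, rule_format, of "P i *v x" u] by simp
      then show "vdot P i x ((Abar i + Bbar i ** K i) *v x + E i *v u)
        + (norm ((C i + D i ** K i) *v x + F i *v u))\<^sup>2 \<le> (\<rho> - e) * (norm u)\<^sup>2"
        using dec[OF i] vdot[OF iN] by (simp add: inner_add_right)
    qed (use e in auto)
    also have "\<dots> < ennreal \<rho>" using e(1) \<rho>_pos by (intro ennreal_lessI) auto
    finally show ?thesis .
  qed
  ultimately show ?thesis by simp
qed

end
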